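(* Let $\mathcal{C}_1,\mathcal{C}_2\subseteq\mathbb{Z}_2^\alpha\times\mathbb{Z}_4^\beta$ be any two additive extended perfect codes of dual type $(\alpha,\beta;\bar\gamma,\bar\delta)$ with $\alpha\neq 0$. Then the intersection code $\mathcal{C}_1\cap\mathcal{C}_2$ is of dual type $(\alpha,\beta;\gamma,\delta;\kappa)$, where: - if $\bar\delta=0$, then $\delta=0$ and $\bar\gamma\leq\kappa=\gamma\leq 2\bar\gamma-1$; - if $\bar\delta=1$, then $\delta=1$ and $\bar\gamma\leq\kappa\leq\gamma\leq 2\bar\gamma$; - if $\bar\delta>1$, then $\delta\in\{\bar\delta,\ldots,2\bar\delta\}$ and $\bar\gamma\leq\kappa\leq\gamma\leq 2\bar\gamma+2\bar\delta-\delta-1$.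
   Context: An additive code is a subgroup $\mathcal{C}$ of $\mathbb{Z}_2^{\alpha}\times\mathbb{Z}_4^{\beta}$. It is of type $(\alpha,\beta;\gamma,\delta)$ if $\mathcal{C}\cong\mathbb{Z}_2^{\gamma}\times\mathbb{Z}_4^{\delta}$ as a group, and of type $(\alpha,\beta;\gamma,\delta;\kappa)$ if moreover $\kappa$ is the dimension over $\mathbb{Z}_2$ of the projection to the $\alpha$ binary coordinates of the subgroup $\{c\in\mathcal{C}:2c=0\}$. The inner product is $\langle u,v\rangle=2\big(\sum_{i=1}^{\alpha}u_iv_i\big)+\sum_{j=\alpha+1}^{\alpha+\beta}u_jv_j\in\mathbb{Z}_4$, and $\mathcal{C}^\perp=\{u:\langle u,v\rangle=0\text{ for all }v\in\mathcal{C}\}$. A code is of dual type $(\ldots)$ if its additive dual is of type $(\ldots)$. The Gray map $\Phi:\mathbb{Z}_2^\alpha\times\mathbb{Z}_4^\beta\to\mathbb{Z}_2^{\alpha+2\beta}$ is the identity on binary coordinates and sends each quaternary coordinate by $0\mapsto(0,0),\ 1\mapsto(0,1),\ 2\mapsto(1,1),\ 3\mapsto(1,0)$. An additive extended perfect code is an additive code $\mathcal{C}$ such that $\Phi(\mathcal{C})$ has the parameters of an extended perfect binary code: length $\alpha+2\beta=2^t$, $2^{2^t-t-1}$ codewords, minimum Hamming distance $4$ (for some $t\ge 2$). *)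

theory Defs
  imports
    "Jordan_Normal_Form.VS_Connect"
    "HOL-Library.Z2"
    "HOL-Library.Numeral_Type"
begin

text \<open>
  Both \<open>bit\<close> (the field with two elements) and the type \<open>4\<close> (the ring of integers modulo 4)
  are type-class rings; vectors of variable length are those of \<open>carrier_vec\<close>, so that
  either of the lengths \<open>\<alpha>\<close> and \<open>\<beta>\<close> may be zero.
\<close>

definition Z2Z4 :: "nat \<Rightarrow> nat \<Rightarrow> (bit vec \<times> 4 vec) monoid" where
  "Z2Z4 \<alpha> \<beta> = monoid_vec TYPE(bit) \<alpha> \<times>\<times> monoid_vec TYPE(4) \<beta>"

definition additive_code :: "nat \<Rightarrow> nat \<Rightarrow> (bit vec \<times> 4 vec) set \<Rightarrow> bool" where
  "additive_code \<alpha> \<beta> C \<longleftrightarrow> subgroup C (Z2Z4 \<alpha> \<beta>)"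

definition of_type ::
    "nat \<Rightarrow> nat \<Rightarrow> nat \<Rightarrow> nat \<Rightarrow> (bit vec \<times> 4 vec) set \<Rightarrow> bool" where
  "of_type \<alpha> \<beta> \<gamma> \<delta> C \<longleftrightarrow>
     additive_code \<alpha> \<beta> C \<and> (Z2Z4 \<alpha> \<beta>)\<lparr>carrier := C\<rparr> \<cong> Z2Z4 \<gamma> \<delta>"

definition binary_torsion_projection ::
    "nat \<Rightarrow> nat \<Rightarrow> (bit vec \<times> 4 vec) set \<Rightarrow> bit vec set" where
  "binary_torsion_projection \<alpha> \<beta> C =
     fst ` {c \<in> C. c \<otimes>\<^bsub>Z2Z4 \<alpha> \<beta>\<^esub> c = \<one>\<^bsub>Z2Z4 \<alpha> \<beta>\<^esub>}"

definition kappa :: "nat \<Rightarrow> nat \<Rightarrow> (bit vec \<times> 4 vec) set \<Rightarrow> nat" where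
  "kappa \<alpha> \<beta> C =
     vectorspace.dim (class_ring :: bit ring)
       ((module_vec TYPE(bit) \<alpha>)\<lparr>carrier := binary_torsion_projection \<alpha> \<beta> C\<rparr>)"

definition of_full_type ::
    "nat \<Rightarrow> nat \<Rightarrow> nat \<Rightarrow> nat \<Rightarrow> nat \<Rightarrow> (bit vec \<times> 4 vec) set \<Rightarrow> bool" where
  "of_full_type \<alpha> \<beta> \<gamma> \<delta> \<kappa> C \<longleftrightarrow> of_type \<alpha> \<beta> \<gamma> \<delta> C \<and> kappa \<alpha> \<beta> C = \<kappa>"

text \<open>The entries of the binary parts enter the inner product as the residues 0 and 1 modulo 4.\<close>

definition inner_Z4 :: "bit vec \<times> 4 vec \<Rightarrow> bit vec \<times> 4 vec \<Rightarrow> 4" where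
  "inner_Z4 u v =
     2 * (\<Sum>i < dim_vec (fst v). of_bit (fst u $ i) * of_bit (fst v $ i)) + snd u \<bullet> snd v"

definition additive_dual ::
    "nat \<Rightarrow> nat \<Rightarrow> (bit vec \<times> 4 vec) set \<Rightarrow> (bit vec \<times> 4 vec) set" where
  "additive_dual \<alpha> \<beta> C = {u \<in> carrier (Z2Z4 \<alpha> \<beta>). \<forall>v\<in>C. inner_Z4 u v = 0}"

definition of_dual_type ::
    "nat \<Rightarrow> nat \<Rightarrow> nat \<Rightarrow> nat \<Rightarrow> (bit vec \<times> 4 vec) set \<Rightarrow> bool" where
  "of_dual_type \<alpha> \<beta> \<gamma> \<delta> C \<longleftrightarrow> of_type \<alpha> \<beta> \<gamma> \<delta> (additive_dual \<alpha> \<beta> C)"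

definition of_full_dual_type ::
    "nat \<Rightarrow> nat \<Rightarrow> nat \<Rightarrow> nat \<Rightarrow> nat \<Rightarrow> (bit vec \<times> 4 vec) set \<Rightarrow> bool" where
  "of_full_dual_type \<alpha> \<beta> \<gamma> \<delta> \<kappa> C \<longleftrightarrow> of_full_type \<alpha> \<beta> \<gamma> \<delta> \<kappa> (additive_dual \<alpha> \<beta> C)"

definition gray4 :: "4 \<Rightarrow> bit \<times> bit" where
  "gray4 x = (if x = 0 then (0, 0) else if x = 1 then (0, 1) else if x = 2 then (1, 1) else (1, 0))"

text \<open>Coordinates \<open>2 * j\<close> and \<open>2 * j + 1\<close> of the second block form the image of the \<open>j\<close>-th
  quaternary coordinate.\<close>

definition Gray :: "bit vec \<times> 4 vec \<Rightarrow> bit vec" where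
  "Gray u = fst u @\<^sub>v
     vec (2 * dim_vec (snd u))
       (\<lambda>k. let p = gray4 (snd u $ (k div 2)) in if even k then fst p else snd p)"

definition hamming_dist :: "bit vec \<Rightarrow> bit vec \<Rightarrow> nat" where
  "hamming_dist x y = card {i. i < dim_vec x \<and> x $ i \<noteq> y $ i}"

definition min_hamming_dist :: "bit vec set \<Rightarrow> nat" where
  "min_hamming_dist X = Min {hamming_dist x y | x y. x \<in> X \<and> y \<in> X \<and> x \<noteq> y}"

definition extended_perfect_parameters :: "nat \<Rightarrow> bit vec set \<Rightarrow> bool" where
  "extended_perfect_parameters n X \<longleftrightarrow>
     X \<subseteq> carrier_vec n \<and>
     (\<exists>t\<ge>2. n = 2 ^ t \<and> card X = 2 ^ (2 ^ t - t - 1) \<and> min_hamming_dist X = 4)"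

definition additive_extended_perfect ::
    "nat \<Rightarrow> nat \<Rightarrow> (bit vec \<times> 4 vec) set \<Rightarrow> bool" where
  "additive_extended_perfect \<alpha> \<beta> C \<longleftrightarrow>
     additive_code \<alpha> \<beta> C \<and> extended_perfect_parameters (\<alpha> + 2 * \<beta>) (Gray ` C)"

end

theory Submission
  imports Defs Complex_Main "HOL-Library.Function_Algebras" "HOL-Library.Product_Plus"
begin

text \<open>
  Write \<open>D\<^sub>i\<close> for the dual of \<open>C\<^sub>i\<close>. Double duality, which follows from the orthogonality relations
  for the characters \<open>u \<mapsto> \<i> ^ \<langle>u, v\<rangle>\<close>, shows that the dual of the intersection is \<open>D = D\<^sub>1 + D\<^sub>2\<close>. A group of
  exponent four is isomorphic to \<open>\<int>\<^sub>2\<^sup>\<gamma> \<times> \<int>\<^sub>4\<^sup>\<delta>\<close>, where \<open>2\<^sup>\<delta>\<close> is the order of \<open>2D\<close> and \<open>2\<^bsup>\<gamma> + \<delta>\<^esup>\<close> the order of its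
  2-torsion, so everything is a count of these two subgroups.

  By the sphere packing bound the vectors at distance one from an extended perfect code make up half
  of the space, and this set is exchanged with its complement by every unit vector; so it consists of
  the vectors of odd weight, and \<open>D\<^sub>i\<close> contains the vector \<open>(1, \<dots>, 1 | 2, \<dots>, 2)\<close>. This common element is
  not in \<open>2D\<^sub>i\<close>, as \<open>\<alpha> \<noteq> 0\<close>, whence the \<open>- 1\<close> in the upper bound for \<open>\<gamma>\<close>. A vector \<open>d\<close> of \<open>D\<^sub>i\<close> with zero
  binary part belongs to \<open>2D\<^sub>i\<close>: by duality it has to be orthogonal to every \<open>u\<close> with \<open>2u \<in> C\<^sub>i\<close>, and, after
  adding a binary unit vector if necessary, \<open>u\<close> has odd weight and so differs from a codeword by a unit
  vector \<open>e\<close> with \<open>2e \<in> C\<^sub>i\<close>, which must be a binary one. This yields \<open>\<gamma>' \<le> \<kappa>\<close>. Since \<open>C\<^sub>i\<close> contains no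
  vector \<open>2e\<close> with \<open>e\<close> a quaternary unit vector, each quaternary coordinate is odd somewhere on \<open>D\<^sub>i\<close>;
  this settles the cases \<open>\<delta>' \<le> 1\<close>.
\<close>

section \<open>Subgroups and additive maps\<close>

declare add_bit_eq_xor [simp del] mult_bit_eq_and [simp del]

text \<open>Stated for types of class \<open>ab_group_add\<close>, whose arithmetic then applies
  directly. The lemmas \<open>subgrp_emb\<close> and \<open>additive_code_of_emb\<close> link it to
  the record-based \<open>subgroup\<close> in which codes are defined.\<close>

definition subgrp :: "'a::ab_group_add set \<Rightarrow> bool" where
  "subgrp H \<longleftrightarrow> 0 \<in> H \<and> (\<forall>x\<in>H. \<forall>y\<in>H. x + y \<in> H) \<and> (\<forall>x\<in>H. - x \<in> H)"

definition additive_on :: "'a::ab_group_add set \<Rightarrow> ('a \<Rightarrow> 'b::ab_group_add) \<Rightarrow> bool" where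
  "additive_on H f \<longleftrightarrow> (\<forall>x\<in>H. \<forall>y\<in>H. f (x + y) = f x + f y)"

definition dbl :: "'a::ab_group_add set \<Rightarrow> 'a set" where
  "dbl H = (\<lambda>x. x + x) ` H"

definition tors :: "'a::ab_group_add set \<Rightarrow> 'a set" where
  "tors H = {x \<in> H. x + x = 0}"

lemma subgrpD:
  assumes "subgrp H"
  shows "0 \<in> H" "x \<in> H \<Longrightarrow> y \<in> H \<Longrightarrow> x + y \<in> H" "x \<in> H \<Longrightarrow> - x \<in> H"
    "x \<in> H \<Longrightarrow> y \<in> H \<Longrightarrow> x - y \<in> H"
proof -
  show "0 \<in> H" "x \<in> H \<Longrightarrow> y \<in> H \<Longrightarrow> x + y \<in> H" "x \<in> H \<Longrightarrow> - x \<in> H"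
    using assms by (auto simp: subgrp_def)
  show "x - y \<in> H" if "x \<in> H" "y \<in> H"
    using assms that unfolding subgrp_def by (metis diff_conv_add_uminus)
qed

lemma subgrp_sum: "subgrp H \<Longrightarrow> (\<And>i. i \<in> I \<Longrightarrow> f i \<in> H) \<Longrightarrow> sum f I \<in> H"
  by (induction I rule: infinite_finite_induct) (auto intro: subgrpD)

lemma additive_onD:
  assumes "additive_on H f" "subgrp H"
  shows "x \<in> H \<Longrightarrow> y \<in> H \<Longrightarrow> f (x + y) = f x + f y" "f 0 = 0" "x \<in> H \<Longrightarrow> f (- x) = - f x"
    "x \<in> H \<Longrightarrow> y \<in> H \<Longrightarrow> f (x - y) = f x - f y"
proof -
  show add: "f (x + y) = f x + f y" if "x \<in> H" "y \<in> H" for x y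
    using assms that by (auto simp: additive_on_def)
  show zero: "f 0 = 0" using add[of 0 0] subgrpD[OF assms(2)] by simp
  show neg: "f (- x) = - f x" if "x \<in> H" for x
    using add[of x "- x"] subgrpD(3)[OF assms(2) that] that zero
    by (simp add: eq_neg_iff_add_eq_0 add.commute)
  show "f (x - y) = f x - f y" if "x \<in> H" "y \<in> H"
    using add[of x "- y"] neg[of y] subgrpD(3)[OF assms(2)] that by simp
qed

lemma additive_double: "additive_on H (\<lambda>x. x + x)"
  by (auto simp: additive_on_def algebra_simps)

lemma subgrp_image:
  assumes "subgrp H" "additive_on H f"
  shows "subgrp (f ` H)"
  unfolding subgrp_def
proof (intro conjI ballI)
  show "0 \<in> f ` H" using additive_onD(2)[OF assms(2,1)] subgrpD(1)[OF assms(1)] by force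
  fix x assume "x \<in> f ` H"
  then obtain a where a: "a \<in> H" "x = f a" by auto
  show "- x \<in> f ` H" using a additive_onD(3)[OF assms(2,1)] subgrpD(3)[OF assms(1)] by force
  fix y assume "y \<in> f ` H"
  then obtain b where b: "b \<in> H" "y = f b" by auto
  show "x + y \<in> f ` H" using a b additive_onD(1)[OF assms(2,1)] subgrpD(2)[OF assms(1)] by force
qed

lemma subgrp_dbl: "subgrp H \<Longrightarrow> subgrp (dbl H)"
  unfolding dbl_def by (intro subgrp_image additive_double)

lemma subgrp_kernel:
  assumes "subgrp H" "additive_on H f"
  shows "subgrp {x \<in> H. f x = 0}"
  using subgrpD[OF assms(1)] additive_onD[OF assms(2,1)] by (auto simp: subgrp_def)

lemma subgrp_tors: "subgrp H \<Longrightarrow> subgrp (tors H)"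
  unfolding tors_def by (rule subgrp_kernel[OF _ additive_double])

text \<open>Every nonempty fibre is a translate of the kernel by a preimage. The lemma is applied to
  doubling, to addition on a product of two subgroups and to the projection on the binary
  part.\<close>

lemma card_image_kernel:
  assumes "subgrp H" "additive_on H f" "finite H"
  shows "card H = card (f ` H) * card {x \<in> H. f x = 0}"
proof -
  have "card {x \<in> H. f x = y} = card {x \<in> H. f x = 0}" if "y \<in> f ` H" for y
  proof -
    from that obtain a where a: "a \<in> H" "y = f a" by auto
    have "bij_betw (\<lambda>x. x + a) {x \<in> H. f x = 0} {x \<in> H. f x = y}"
      by (rule bij_betwI[where g = "\<lambda>x. x - a"])
         (use a subgrpD[OF assms(1)] additive_onD[OF assms(2,1)] in auto)
    thus ?thesis by (simp add: bij_betw_same_card)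
  qed
  hence "(\<Sum>y\<in>f ` H. card {x \<in> H. f x = y}) = card (f ` H) * card {x \<in> H. f x = 0}"
    by simp
  moreover have "card H = (\<Sum>y\<in>f ` H. card {x \<in> H. f x = y})"
    using sum.image_gen[OF assms(3), of "\<lambda>_. 1::nat" f] by simp
  ultimately show ?thesis by simp
qed

lemma card_dbl_tors: "subgrp H \<Longrightarrow> finite H \<Longrightarrow> card H = card (dbl H) * card (tors H)"
  unfolding dbl_def tors_def by (rule card_image_kernel[OF _ additive_double])

lemma inj_on_additive_iff:
  assumes "subgrp H" "additive_on H f"
  shows "inj_on f H \<longleftrightarrow> (\<forall>x\<in>H. f x = 0 \<longrightarrow> x = 0)"
proof
  assume "inj_on f H"
  thus "\<forall>x\<in>H. f x = 0 \<longrightarrow> x = 0"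
    using additive_onD(2)[OF assms(2,1)] subgrpD(1)[OF assms(1)] by (metis inj_onD)
next
  assume *: "\<forall>x\<in>H. f x = 0 \<longrightarrow> x = 0"
  show "inj_on f H"
  proof (rule inj_onI)
    fix x y assume "x \<in> H" "y \<in> H" "f x = f y"
    hence "f (x - y) = 0" "x - y \<in> H"
      using additive_onD(4)[OF assms(2,1)] subgrpD(4)[OF assms(1)] by auto
    thus "x = y" using * by (metis right_minus_eq)
  qed
qed

lemma card_tors_bij:
  assumes "subgrp H" "additive_on H f" "inj_on f H"
  shows "card (tors (f ` H)) = card (tors H)"
proof -
  have "tors (f ` H) = f ` tors H"
  proof -
    have "f x + f x = 0 \<longleftrightarrow> x + x = 0" if "x \<in> H" for x
    proof -
      have "f x + f x = f (x + x)" "x + x \<in> H"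
        using that additive_onD(1)[OF assms(2,1)] subgrpD(2)[OF assms(1)] by auto
      thus ?thesis
        using assms(3) inj_on_additive_iff[OF assms(1,2)] additive_onD(2)[OF assms(2,1)] by auto
    qed
    thus ?thesis by (auto simp: tors_def)
  qed
  moreover have "inj_on f (tors H)" using assms(3) by (rule inj_on_subset) (auto simp: tors_def)
  ultimately show ?thesis by (simp add: card_image)
qed

section \<open>Finite abelian groups of exponent four\<close>

text \<open>
  Vectors of length \<open>n\<close> are represented by functions that vanish from \<open>n\<close> on: unlike those of
  \<^const>\<open>carrier_vec\<close>, these lie in a type of class \<^class>\<open>ab_group_add\<close>.
\<close>

definition supported :: "nat \<Rightarrow> (nat \<Rightarrow> 'a::zero) set" where
  "supported n = {x. \<forall>i\<ge>n. x i = 0}"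

definition mixed :: "nat \<Rightarrow> nat \<Rightarrow> ((nat \<Rightarrow> bit) \<times> (nat \<Rightarrow> 4)) set" where
  "mixed \<alpha> \<beta> = supported \<alpha> \<times> supported \<beta>"

text \<open>The set \<open>A\<close> of values is a parameter because two instances occur: all
  values, and the residues 0 and 2, which doubling kills.\<close>

lemma card_supported_values:
  fixes A :: "'a::zero set"
  assumes "finite A"
  shows "finite {x \<in> supported n. \<forall>i<n. x i \<in> A}" (is "finite ?S")
    and "card {x \<in> supported n. \<forall>i<n. x i \<in> A} = card A ^ n"
proof -
  have b: "bij_betw (\<lambda>x. restrict x {..<n}) ?S ({..<n} \<rightarrow>\<^sub>E A)"
    by (rule bij_betwI[where g = "\<lambda>x i. if i < n then x i else 0"])
       (auto simp: supported_def fun_eq_iff PiE_iff extensional_def)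
  have "finite ({..<n} \<rightarrow>\<^sub>E A)" using assms by (intro finite_PiE) auto
  with b show "finite ?S" using bij_betw_finite by blast
  from b show "card ?S = card A ^ n"
    by (simp add: bij_betw_same_card card_PiE)
qed

lemma card_supported:
  fixes S :: "(nat \<Rightarrow> 'a::zero) set"
  assumes "S = supported n" "finite (UNIV :: 'a set)"
  shows "finite S" "card S = CARD('a) ^ n"
  using card_supported_values[of "UNIV :: 'a set" n] assms by auto

lemma subgrp_supported: "subgrp (supported n :: (nat \<Rightarrow> 'a::ab_group_add) set)"
  by (auto simp: subgrp_def supported_def)

lemma subgrp_Times: "subgrp A \<Longrightarrow> subgrp B \<Longrightarrow> subgrp (A \<times> B)"
  by (auto simp: subgrp_def zero_prod_def)

lemma subgrp_mixed: "subgrp (mixed \<alpha> \<beta>)"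
  unfolding mixed_def by (intro subgrp_Times subgrp_supported)

lemma UNIV_4: "(UNIV :: 4 set) = {0, 1, 2, 3}"
proof -
  have "card {0, 1, 2, 3 :: 4} = CARD(4)" by simp
  thus ?thesis by (metis card_subset_eq finite subset_UNIV)
qed

lemma cases_4: "(x::4) = 0 \<or> x = 1 \<or> x = 2 \<or> x = 3"
  using UNIV_4 by auto

lemma arith_4:
  "(1::4) + 1 = 2" "(1::4) + 2 = 3" "(1::4) + 3 = 0" "(2::4) + 1 = 3" "(2::4) + 2 = 0" "(2::4) + 3 = 1"
  "(3::4) + 1 = 0" "(3::4) + 2 = 1" "(3::4) + 3 = 2" "- (1::4) = 3" "- (2::4) = 2" "- (3::4) = 1"
  "(2::4) * 2 = 0" "(2::4) * 3 = 2" "(3::4) * 2 = 2" "(3::4) * 3 = 1"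
  by simp_all

lemma cases_bit: "(x::bit) = 0 \<or> x = 1"
  by (cases x) auto

lemma card_UNIV_bit: "finite (UNIV :: bit set)" "CARD(bit) = 2"
proof -
  have *: "(UNIV :: bit set) = {0, 1}" using cases_bit by auto
  have "card {0, 1 :: bit} = 2" by simp
  with * show "CARD(bit) = 2" by metis
  show "finite (UNIV :: bit set)" by (subst *) simp
qed

lemma card_supported_bit:
  "finite (supported n :: (nat \<Rightarrow> bit) set)" "card (supported n :: (nat \<Rightarrow> bit) set) = 2 ^ n"
  using card_supported[OF refl card_UNIV_bit(1)] by (simp_all add: card_UNIV_bit)

lemma card_mixed: "finite (mixed \<alpha> \<beta>)" "card (mixed \<alpha> \<beta>) = 2 ^ (\<alpha> + 2 * \<beta>)"
proof -
  have "(4::nat) ^ \<beta> = 2 ^ (2 * \<beta>)" by (simp add: power_mult)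
  thus "finite (mixed \<alpha> \<beta>)" "card (mixed \<alpha> \<beta>) = 2 ^ (\<alpha> + 2 * \<beta>)"
    by (auto simp: mixed_def card_cartesian_product card_supported_bit card_supported[OF refl finite] power_add)
qed

text \<open>Doubling kills every binary vector and exactly those quaternary vectors whose entries
  are 0 or 2.\<close>

lemma card_tors_mixed: "card (tors (mixed \<gamma> \<delta>)) = 2 ^ (\<gamma> + \<delta>)"
proof -
  have bb: "(b::bit) + b = 0" for b by (cases b) auto
  have ff: "(x::4) + x = 0 \<longleftrightarrow> x \<in> {0, 2}" for x using cases_4[of x] by (auto simp: arith_4)
  have "tors (mixed \<gamma> \<delta>) = supported \<gamma> \<times> {y \<in> supported \<delta>. \<forall>i<\<delta>. y i \<in> {0, 2}}"
  proof -
    have "x + x = 0" if "x \<in> supported \<gamma>" for x :: "nat \<Rightarrow> bit"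
      using bb by (auto simp: fun_eq_iff)
    moreover have "y + y = 0 \<longleftrightarrow> (\<forall>i<\<delta>. y i \<in> {0, 2})" if "y \<in> supported \<delta>" for y :: "nat \<Rightarrow> 4"
      using that unfolding fun_eq_iff plus_fun_apply zero_fun_apply ff
      by (auto simp: supported_def) (metis not_le)
    ultimately show ?thesis by (auto simp: tors_def mixed_def zero_prod_def)
  qed
  moreover have "card {0, 2::4} = 2" by simp
  ultimately show ?thesis
    by (simp only: card_cartesian_product card_supported_bit card_supported_values power_add finite.intros)
qed

text \<open>Recovers \<gamma> and \<delta> from two orders that depend on \<open>H\<close> alone.
  Statements about types thereby become comparisons of powers of two.\<close>

lemma card_iso_mixed:
  assumes "additive_on (mixed \<gamma> \<delta>) f" "bij_betw f (mixed \<gamma> \<delta>) H"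
  shows "card (tors H) = 2 ^ (\<gamma> + \<delta>)" "card (dbl H) = 2 ^ \<delta>" "finite H" "subgrp H"
proof -
  have H: "H = f ` mixed \<gamma> \<delta>" "inj_on f (mixed \<gamma> \<delta>)" using assms(2) by (auto simp: bij_betw_def)
  show "finite H" "subgrp H" using H subgrp_image[OF subgrp_mixed assms(1)] card_mixed(1) by auto
  show "card (tors H) = 2 ^ (\<gamma> + \<delta>)"
    using card_tors_bij[OF subgrp_mixed assms(1) H(2)] H(1) card_tors_mixed by simp
  have "card H = card (mixed \<gamma> \<delta>)" using assms(2) bij_betw_same_card by metis
  thus "card (dbl H) = 2 ^ \<delta>" 
    using card_dbl_tors[OF \<open>subgrp H\<close> \<open>finite H\<close>] \<open>card (tors H) = _\<close>
    by (simp add: card_mixed(2) power_add mult_2)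
qed

section \<open>Linear combinations over the field with two elements, and the structure
  theorem\<close>

definition scale2 :: "bit \<Rightarrow> 'a::ab_group_add \<Rightarrow> 'a" where
  "scale2 x b = (if x = 0 then 0 else b)"

text \<open>Like \<open>scale2\<close>, the multiple of a group element by a representative of a
  residue. Additivity in the residue requires the element to be killed by 4, respectively by 2; this
  is the assumption of \<open>scale4_add\<close> and \<open>scale2_add\<close>.\<close>

definition scale4 :: "4 \<Rightarrow> 'a::ab_group_add \<Rightarrow> 'a" where
  "scale4 y a = (if y = 0 then 0 else if y = 1 then a else if y = 2 then a + a else a + a + a)"

definition comb2 :: "nat \<Rightarrow> (nat \<Rightarrow> 'a::ab_group_add) \<Rightarrow> (nat \<Rightarrow> bit) \<Rightarrow> 'a" where
  "comb2 k b x = (\<Sum>i<k. scale2 (x i) (b i))"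

lemma scale2_add: "b + b = 0 \<Longrightarrow> scale2 (x + y) b = scale2 x b + scale2 y b"
  using cases_bit[of x] cases_bit[of y] by (auto simp: scale2_def)

lemma scale4_add:
  assumes "a + a + (a + a) = 0"
  shows "scale4 (x + y) a = scale4 x a + scale4 y a"
proof -
  have "a + (a + (a + a)) = 0" "\<And>z. a + (a + (a + (a + z))) = z"
    using assms by (auto simp: add.assoc[symmetric])
  thus ?thesis using cases_4[of x] cases_4[of y]
    by (elim disjE) (simp_all add: scale4_def add.assoc)
qed

lemma additive_comb2: "(\<And>i. i < k \<Longrightarrow> b i + b i = 0) \<Longrightarrow> additive_on H (comb2 k b)"
  unfolding additive_on_def comb2_def sum.distrib[symmetric] plus_fun_apply
  by (intro ballI sum.cong refl scale2_add) auto

lemma comb2_in: "subgrp V \<Longrightarrow> (\<And>i. i < k \<Longrightarrow> b i \<in> V) \<Longrightarrow> comb2 k b x \<in> V"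
  unfolding comb2_def by (rule subgrp_sum) (auto simp: scale2_def subgrpD)

lemma inj_on_comb2_iff:
  assumes "\<And>i. i < k \<Longrightarrow> b i + b i = 0"
  shows "inj_on (comb2 k b) (supported k) \<longleftrightarrow> (\<forall>x\<in>supported k. comb2 k b x = 0 \<longrightarrow> x = 0)"
  by (rule inj_on_additive_iff[OF subgrp_supported additive_comb2[OF assms]])

text \<open>Injectivity of \<open>comb2 k b\<close> on \<open>supported k\<close> is linear
  independence of the first \<open>k\<close> vectors. As long as their span is proper, a vector
  outside it is appended. The form of an extension, rather than mere existence of a basis, is what
  lets a basis of \<open>dbl D\<close> be continued to one of \<open>tors D\<close>.\<close>

lemma extend_basis2:
  fixes V :: "'a::ab_group_add set"
  assumes "subgrp V" "finite V" and V2: "\<And>v. v \<in> V \<Longrightarrow> v + v = 0"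
    and "\<And>i. i < k \<Longrightarrow> b i \<in> V" "inj_on (comb2 k b) (supported k)"
  shows "\<exists>m b'. k \<le> m \<and> (\<forall>i<k. b' i = b i) \<and> (\<forall>i<m. b' i \<in> V) \<and>
    bij_betw (comb2 m b') (supported m) V"
  using assms(4,5)
proof (induction "card V - 2 ^ k" arbitrary: k b rule: less_induct)
  case less
  have sub: "comb2 k b ` supported k \<subseteq> V" using comb2_in[OF assms(1), of k b] less.prems(1) by auto
  have ck: "card (comb2 k b ` supported k) = 2 ^ k"
    using less.prems(2) card_supported_bit by (simp add: card_image)
  show ?case
  proof (cases "comb2 k b ` supported k = V")
    case True
    hence "bij_betw (comb2 k b) (supported k) V" using less.prems(2) by (simp add: bij_betw_def)
    with less.prems(1) show ?thesis by (intro exI[of _ k] exI[of _ b]) simp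
  next
    case False
    with sub obtain v where v: "v \<in> V" "v \<notin> comb2 k b ` supported k" by blast
    define b' where "b' = b(k := v)"
    have b': "b' i \<in> V" if "i < Suc k" for i using that v less.prems(1) by (auto simp: b'_def)
    have split: "comb2 (Suc k) b' x = comb2 k b (x(k := 0)) + scale2 (x k) v" for x
      by (simp add: comb2_def b'_def)
    have inj: "inj_on (comb2 (Suc k) b') (supported (Suc k))"
    proof (subst inj_on_additive_iff[OF subgrp_supported])
      show "additive_on (supported (Suc k)) (comb2 (Suc k) b')"
        using b' V2 by (intro additive_comb2) auto
      show "\<forall>x\<in>supported (Suc k). comb2 (Suc k) b' x = 0 \<longrightarrow> x = 0"
      proof (intro ballI impI)
        fix x :: "nat \<Rightarrow> bit" assume x: "x \<in> supported (Suc k)" "comb2 (Suc k) b' x = 0"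
        have x0: "x(k := 0) \<in> supported k" using x(1) by (auto simp: supported_def)
        \<comment> \<open>A nonzero coefficient would put \<open>v\<close>, which equals its own
          negative, into the span of the old vectors.\<close>
        have "x k = 0"
        proof (rule ccontr)
          assume "x k \<noteq> 0"
          hence "comb2 k b (x(k := 0)) + v = 0" using x(2) split[of x] by (simp add: scale2_def)
          also have "\<dots> = v + v" using V2[OF v(1)] by simp
          finally have "comb2 k b (x(k := 0)) = v" by (simp only: add_right_cancel)
          with v(2) x0 show False by blast
        qed
        hence xk: "x(k := 0) = x" by auto
        hence "comb2 k b x = 0" using x(2) split[of x] \<open>x k = 0\<close> by (simp add: scale2_def)
        moreover have "b i + b i = 0" if "i < k" for i using less.prems(1) V2 that by blast
        ultimately show "x = 0"
          using less.prems(2) x0 unfolding xk by (simp add: inj_on_comb2_iff)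
      qed
    qed
    \<comment> \<open>The span has \<open>2 ^ k\<close> elements and is proper. Hence the truncated
      difference that serves as induction measure is positive and really drops.\<close>
    have "2 ^ k < card V"
      using psubset_card_mono[OF assms(2), of "comb2 k b ` supported k"] sub False
      unfolding ck by blast
    hence "card V - 2 ^ Suc k < card V - 2 ^ k" by (intro diff_less_mono2) simp_all
    hence "\<exists>m b''. Suc k \<le> m \<and> (\<forall>i<Suc k. b'' i = b' i) \<and> (\<forall>i<m. b'' i \<in> V) \<and>
      bij_betw (comb2 m b'') (supported m) V"
      by (rule less.hyps) (fact b' inj)+
    then obtain m b'' where
      m: "Suc k \<le> m" "\<forall>i<Suc k. b'' i = b' i" "\<forall>i<m. b'' i \<in> V" "bij_betw (comb2 m b'') (supported m) V"
      by (elim exE conjE)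
    show ?thesis
      by (intro exI[of _ m] exI[of _ b'']) (use m in \<open>auto simp: b'_def\<close>)
  qed
qed

lemma sum_lessThan_add:
  "(\<Sum>i<m + n::nat. f i) = (\<Sum>i<m. f i) + (\<Sum>i<n. f (m + i) :: 'a::comm_monoid_add)"
  by (induction n) (simp_all add: add.assoc)

text \<open>A basis \<open>c\<close> of \<open>dbl D\<close> is halved to elements \<open>a\<close>
  and extended to a basis \<open>b\<close> of \<open>tors D\<close>. The \<open>a\<close> generate
  the summands of order four, the added vectors those of order two. Injectivity follows from the two
  independences, surjectivity from a count.\<close>

lemma exponent_four_structure:
  fixes D :: "'a::ab_group_add set"
  assumes "subgrp D" "finite D" and D4: "\<And>x. x \<in> D \<Longrightarrow> x + x + (x + x) = 0"
  shows "\<exists>\<gamma> \<delta> f. additive_on (mixed \<gamma> \<delta>) f \<and> bij_betw f (mixed \<gamma> \<delta>) D"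
proof -
  have dt: "dbl D \<subseteq> tors D" using subgrpD[OF assms(1)] D4 by (auto simp: dbl_def tors_def)
  have t2: "v + v = 0" if "v \<in> tors D" for v using that by (auto simp: tors_def)
  have fin: "finite (dbl D)" "finite (tors D)" using assms(2) by (auto simp: dbl_def tors_def)
  \<comment> \<open>The empty family is independent, so the extension lemma also yields a basis from
    nothing.\<close>
  have "supported 0 = {0::nat \<Rightarrow> bit}" by (auto simp: supported_def fun_eq_iff)
  with extend_basis2[OF subgrp_dbl[OF assms(1)] fin(1), of 0 "\<lambda>_. 0"] dt t2
  obtain \<delta> c where c: "\<forall>i<\<delta>. c i \<in> dbl D" "bij_betw (comb2 \<delta> c) (supported \<delta>) (dbl D)"
    by auto
  from c(1) have "\<forall>i. \<exists>a. i < \<delta> \<longrightarrow> a \<in> D \<and> c i = a + a" by (auto simp: dbl_def)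
  then obtain a where a: "\<And>i. i < \<delta> \<Longrightarrow> a i \<in> D" "\<And>i. i < \<delta> \<Longrightarrow> c i = a i + a i" by metis
  from extend_basis2[OF subgrp_tors[OF assms(1)] fin(2) t2, of \<delta> c] c dt
  obtain m b where b: "\<delta> \<le> m" "\<forall>i<\<delta>. b i = c i" "\<forall>i<m. b i \<in> tors D"
    "bij_betw (comb2 m b) (supported m) (tors D)" 
    by (auto simp: bij_betw_def) blast
  \<comment> \<open>The first \<delta> vectors of \<open>b\<close> are the doubles of the
    \<open>a\<close>; only the remaining ones give new summands.\<close>
  define \<gamma> where "\<gamma> = m - \<delta>"
  define f where "f = (\<lambda>(x, y). (\<Sum>i<\<gamma>. scale2 (x i) (b (\<delta> + i))) + (\<Sum>j<\<delta>. scale4 (y j) (a j)))"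
  have bb: "b i + b i = 0" if "i < m" for i using b(3) that by (auto simp: tors_def)
  have cc: "c i + c i = 0" if "i < \<delta>" for i using b(1,2) bb[of i] that by auto
  have bD: "b i \<in> D" if "i < m" for i using b(3) that by (auto simp: tors_def)
  have f_in: "f u \<in> D" for u
  proof -
    have "scale4 y (a j) \<in> D" if "j < \<delta>" for j y
      using a(1)[OF that] by (auto simp: scale4_def subgrpD[OF assms(1)])
    moreover have "scale2 x (b (\<delta> + i)) \<in> D" if "i < \<gamma>" for i x
      using bD that by (auto simp: scale2_def subgrpD[OF assms(1)] \<gamma>_def)
    ultimately show ?thesis unfolding f_def case_prod_unfold
      by (auto intro!: subgrpD(2)[OF assms(1)] subgrp_sum[OF assms(1)])
  qed
  have add: "additive_on (mixed \<gamma> \<delta>) f"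
  proof -
    have 1: "scale2 (x + x') (b (\<delta> + i)) = scale2 x (b (\<delta> + i)) + scale2 x' (b (\<delta> + i))"
      if "i < \<gamma>" for i x x' using bb that by (intro scale2_add) (auto simp: \<gamma>_def)
    have 2: "scale4 (y + y') (a j) = scale4 y (a j) + scale4 y' (a j)" if "j < \<delta>" for j y y'
      using D4[OF a(1)[OF that]] by (rule scale4_add)
    show ?thesis
      unfolding additive_on_def f_def
      by (clarsimp simp: 1 2 sum.distrib)
  qed
  have inj: "inj_on f (mixed \<gamma> \<delta>)"
  proof (subst inj_on_additive_iff[OF subgrp_mixed add], intro ballI impI)
    fix u assume u: "u \<in> mixed \<gamma> \<delta>" "f u = 0"
    obtain x y where xy: "u = (x, y)" by (cases u)
    \<comment> \<open>The parity of \<open>y\<close>. Doubling \<open>f u\<close> kills the binary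
      part and leaves the combination of the \<open>c\<close> with coefficients \<open>p\<close>, so
      independence of \<open>c\<close> makes every entry of \<open>y\<close> even.\<close>
    define p where "p = (\<lambda>j. if y j = 0 \<or> y j = 2 then 0 else 1 :: bit)"
    have ys: "y j = 0" if "j \<ge> \<delta>" for j using u(1) that by (auto simp: xy mixed_def supported_def)
    have xs: "x j = 0" if "j \<ge> \<gamma>" for j using u(1) that by (auto simp: xy mixed_def supported_def)
    have "scale2 (x i) (b (\<delta> + i)) + scale2 (x i) (b (\<delta> + i)) = 0" if "i < \<gamma>" for i
      using bb that by (auto simp: scale2_def \<gamma>_def)
    hence X: "(\<Sum>i<\<gamma>. scale2 (x i) (b (\<delta> + i))) + (\<Sum>i<\<gamma>. scale2 (x i) (b (\<delta> + i))) = 0"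
      by (simp flip: sum.distrib)
    have "(X + Y) + (X + Y) = (X + X) + (Y + Y)" for X Y :: 'a by (simp add: algebra_simps)
    hence "f u + f u = (\<Sum>j<\<delta>. scale4 (y j) (a j) + scale4 (y j) (a j))"
      using X by (simp add: f_def xy sum.distrib)
    also have "\<dots> = comb2 \<delta> c p" unfolding comb2_def
    proof (rule sum.cong)
      fix j assume j: "j \<in> {..<\<delta>}"
      have "a j + (a j + (a j + a j)) = 0" using D4[OF a(1)] j by (simp add: add.assoc)
      thus "scale4 (y j) (a j) + scale4 (y j) (a j) = scale2 (p j) (c j)"
        using cases_4[of "y j"] j a(2)
        by (elim disjE) (simp_all add: scale4_def scale2_def p_def add.assoc)
    qed simp
    finally have "comb2 \<delta> c p = 0" using u(2) by simp
    moreover have "p \<in> supported \<delta>" using ys by (auto simp: p_def supported_def)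
    ultimately have "p = 0" using c(2) inj_on_comb2_iff[OF cc] by (auto simp: bij_betw_def)
    hence y02: "y j = 0 \<or> y j = 2" for j by (auto simp: p_def fun_eq_iff split: if_splits)
    \<comment> \<open>Once \<open>y\<close> is even, \<open>f u\<close> is a combination of the
      \<open>b\<close>: an entry 2 of \<open>y\<close> contributes a double
      \<open>a j + a j\<close>, which is \<open>b j\<close>, and the entries of \<open>x\<close>
      follow, shifted by \<delta>.\<close>
    define z where "z = (\<lambda>i. if i < \<delta> then (if y i = 2 then 1 else 0) else x (i - \<delta>))"
    have "comb2 m b z = (\<Sum>i<\<delta>. scale2 (z i) (b i)) + (\<Sum>i<\<gamma>. scale2 (z (\<delta> + i)) (b (\<delta> + i)))"
    proof -
      have "m = \<delta> + \<gamma>" using b(1) by (simp add: \<gamma>_def)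
      show ?thesis unfolding comb2_def \<open>m = \<delta> + \<gamma>\<close>
        by (rule sum_lessThan_add)
    qed
    also have "(\<Sum>i<\<delta>. scale2 (z i) (b i)) = (\<Sum>j<\<delta>. scale4 (y j) (a j))"
    proof (rule sum.cong)
      fix j assume "j \<in> {..<\<delta>}"
      thus "scale2 (z j) (b j) = scale4 (y j) (a j)"
        using y02[of j] b(2) a(2) by (elim disjE) (simp_all add: z_def scale2_def scale4_def)
    qed simp
    also have "(\<Sum>i<\<gamma>. scale2 (z (\<delta> + i)) (b (\<delta> + i))) = (\<Sum>i<\<gamma>. scale2 (x i) (b (\<delta> + i)))"
      by (rule sum.cong) (auto simp: z_def)
    finally have "comb2 m b z = 0" using u(2) by (simp add: f_def xy add.commute)
    moreover have "z \<in> supported m" using xs b(1) by (auto simp: supported_def z_def \<gamma>_def)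
    ultimately have "z = 0" using b(4) inj_on_comb2_iff[OF bb] by (auto simp: bij_betw_def)
    have "y j = 0" for j
      using fun_cong[OF \<open>z = 0\<close>, of j] y02[of j] ys[of j] by (auto simp: z_def split: if_splits)
    moreover have "x i = 0" for i
      using fun_cong[OF \<open>z = 0\<close>, of "\<delta> + i"] by (auto simp: z_def)
    ultimately show "u = 0" by (auto simp: xy zero_prod_def)
  qed
  \<comment> \<open>Here \<open>m = \<gamma> + \<delta>\<close>, so the order is that of
    \<open>mixed \<gamma> \<delta>\<close>, and the injective map \<open>f\<close> is onto.\<close>
  have "card D = 2 ^ \<delta> * 2 ^ m"
    using card_dbl_tors[OF assms(1,2)] bij_betw_same_card[OF c(2)] bij_betw_same_card[OF b(4)]
    by (simp add: card_supported_bit)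
  also have "\<dots> = card (mixed \<gamma> \<delta>)"
    using b(1) by (simp add: card_mixed \<gamma>_def flip: power_add)
  finally have "card (f ` mixed \<gamma> \<delta>) = card D" using inj by (simp add: card_image)
  hence "f ` mixed \<gamma> \<delta> = D" using f_in assms(2) by (intro card_subset_eq) auto
  with add inj show ?thesis by (auto simp: bij_betw_def)
qed

section \<open>Duality\<close>

definition ip :: "nat \<Rightarrow> nat \<Rightarrow> (nat \<Rightarrow> bit) \<times> (nat \<Rightarrow> 4) \<Rightarrow> (nat \<Rightarrow> bit) \<times> (nat \<Rightarrow> 4) \<Rightarrow> 4" where
  "ip \<alpha> \<beta> u v = 2 * (\<Sum>i<\<alpha>. of_bit (fst u i) * of_bit (fst v i)) + (\<Sum>j<\<beta>. snd u j * snd v j)"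

definition perp :: "nat \<Rightarrow> nat \<Rightarrow> ((nat \<Rightarrow> bit) \<times> (nat \<Rightarrow> 4)) set \<Rightarrow> ((nat \<Rightarrow> bit) \<times> (nat \<Rightarrow> 4)) set" where
  "perp \<alpha> \<beta> H = {u \<in> mixed \<alpha> \<beta>. \<forall>v\<in>H. ip \<alpha> \<beta> u v = 0}"

lemma ip_commute: "ip \<alpha> \<beta> u v = ip \<alpha> \<beta> v u"
  by (simp add: ip_def mult.commute)

lemma ip_add_right: "ip \<alpha> \<beta> u (v + w) = ip \<alpha> \<beta> u v + ip \<alpha> \<beta> u w"
proof -
  have "2 * (of_bit a * of_bit (b + c)) = 2 * (of_bit a * of_bit b) + 2 * (of_bit a * of_bit c :: 4)"
    for a b c
    using cases_bit[of b] cases_bit[of c] cases_bit[of a] by (elim disjE) simp_all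
  thus ?thesis
    unfolding ip_def sum_distrib_left fst_add snd_add plus_fun_apply distrib_left
    by (simp only: sum.distrib add_ac)
qed

lemma ip_add_left: "ip \<alpha> \<beta> (u + v) w = ip \<alpha> \<beta> u w + ip \<alpha> \<beta> v w"
  using ip_add_right[of \<alpha> \<beta> w u v] by (simp add: ip_commute)

lemma additive_ip: "additive_on H (ip \<alpha> \<beta> u)"
  by (simp add: additive_on_def ip_add_right)

lemma ip_0: "ip \<alpha> \<beta> u 0 = 0" "ip \<alpha> \<beta> 0 u = 0"
  using ip_add_right[of \<alpha> \<beta> u 0 0] ip_commute[of \<alpha> \<beta> 0 u] by simp_all

lemma ip_diff_right: "ip \<alpha> \<beta> u (v - w) = ip \<alpha> \<beta> u v - ip \<alpha> \<beta> u w"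
  using ip_add_right[of \<alpha> \<beta> u "v - w" w] by (simp add: algebra_simps)

lemma subgrp_perp: "subgrp (perp \<alpha> \<beta> H)"
proof -
  have "ip \<alpha> \<beta> (- u) v = - ip \<alpha> \<beta> u v" for u v
    using ip_add_left[of \<alpha> \<beta> u "- u" v] by (simp add: ip_0 eq_neg_iff_add_eq_0 add.commute)
  thus ?thesis
    using subgrp_mixed[of \<alpha> \<beta>] by (auto simp: perp_def subgrp_def ip_0 ip_add_left)
qed

lemma perp_subset: "perp \<alpha> \<beta> H \<subseteq> mixed \<alpha> \<beta>"
  by (auto simp: perp_def)

definition unit2 :: "nat \<Rightarrow> (nat \<Rightarrow> bit) \<times> (nat \<Rightarrow> 4)" where
  "unit2 i = ((\<lambda>k. if k = i then 1 else 0), 0)"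

definition unit4 :: "4 \<Rightarrow> nat \<Rightarrow> (nat \<Rightarrow> bit) \<times> (nat \<Rightarrow> 4)" where
  "unit4 c j = (0, (\<lambda>k. if k = j then c else 0))"

lemma unit_mixed:
  "i < \<alpha> \<Longrightarrow> unit2 i \<in> mixed \<alpha> \<beta>" "j < \<beta> \<Longrightarrow> unit4 c j \<in> mixed \<alpha> \<beta>"
  by (auto simp: unit2_def unit4_def mixed_def supported_def)

lemma ip_unit2: "i < \<alpha> \<Longrightarrow> ip \<alpha> \<beta> u (unit2 i) = 2 * of_bit (fst u i)"
proof -
  assume "i < \<alpha>"
  have "of_bit (fst u k) * of_bit (if k = i then 1 else 0) = (if k = i then of_bit (fst u k) else 0 :: 4)" for k
    by simp
  thus ?thesis using \<open>i < \<alpha>\<close> by (simp add: ip_def unit2_def)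
qed

lemma ip_unit4: "j < \<beta> \<Longrightarrow> ip \<alpha> \<beta> u (unit4 c j) = snd u j * c"
proof -
  assume "j < \<beta>"
  have "snd u k * (if k = j then c else 0) = (if k = j then snd u k * c else 0 :: 4)" for k
    by simp
  thus ?thesis using \<open>j < \<beta>\<close> by (simp add: ip_def unit4_def)
qed

lemma ip_nondegenerate:
  assumes "u \<in> mixed \<alpha> \<beta>" "\<And>v. v \<in> mixed \<alpha> \<beta> \<Longrightarrow> ip \<alpha> \<beta> u v = 0"
  shows "u = 0"
proof -
  have "fst u i = 0" for i
  proof (cases "i < \<alpha>")
    case True
    hence "2 * of_bit (fst u i) = (0::4)" using assms(2)[OF unit_mixed(1)] by (simp add: ip_unit2)
    thus ?thesis using cases_bit[of "fst u i"] by auto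
  qed (use assms(1) in \<open>auto simp: mixed_def supported_def\<close>)
  moreover have "snd u j = 0" for j
  proof (cases "j < \<beta>")
    case True
    thus ?thesis using assms(2)[OF unit_mixed(2)[of j \<beta> 1]] by (simp add: ip_unit4)
  qed (use assms(1) in \<open>auto simp: mixed_def supported_def\<close>)
  ultimately show ?thesis by (simp add: prod_eq_iff fun_eq_iff)
qed

section \<open>The faithful character of the integers modulo 4, and double duality\<close>

definition chi :: "4 \<Rightarrow> complex" where
  "chi x = (if x = 0 then 1 else if x = 1 then \<i> else if x = 2 then - 1 else - \<i>)"

lemma chi_add: "chi (x + y) = chi x * chi y"
  using cases_4[of x] cases_4[of y] by (elim disjE) (simp_all add: chi_def)

lemma chi_eq_1: "chi x = 1 \<longleftrightarrow> x = 0"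
  using cases_4[of x] by (elim disjE) (simp_all add: chi_def complex_eq_iff)

text \<open>Translation by an \<open>a\<close> with \<open>f a \<noteq> 0\<close> permutes
  \<open>H\<close> and multiplies the sum by \<open>chi (f a)\<close>, which is not 1; the sum
  therefore vanishes.\<close>

lemma sum_chi:
  assumes "subgrp H" "additive_on H f"
  shows "(\<Sum>x\<in>H. chi (f x)) = (if \<forall>x\<in>H. f x = 0 then of_nat (card H) else 0)"
proof (cases "\<forall>x\<in>H. f x = 0")
  case True
  thus ?thesis by (simp add: chi_eq_1)
next
  case False
  then obtain a where a: "a \<in> H" "f a \<noteq> 0" by blast
  have "(\<Sum>x\<in>H. chi (f x)) = (\<Sum>x\<in>H. chi (f (x + a)))"
    by (rule sum.reindex_bij_witness[of _ "\<lambda>x. x + a" "\<lambda>x. x - a"])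
       (use a subgrpD[OF assms(1)] in auto)
  also have "\<dots> = (\<Sum>x\<in>H. chi (f x) * chi (f a))"
    by (rule sum.cong) (use a additive_onD(1)[OF assms(2,1)] in \<open>auto simp: chi_add\<close>)
  also have "\<dots> = (\<Sum>x\<in>H. chi (f x)) * chi (f a)" by (simp add: sum_distrib_right)
  finally have "(\<Sum>x\<in>H. chi (f x)) = 0" using a(2) chi_eq_1 by simp
  with False show ?thesis by (simp only: if_False)
qed

text \<open>The sum of \<open>chi (ip \<alpha> \<beta> u h)\<close> over all \<open>u\<close> and
  \<open>h\<close> is computed in both orders. Summing over \<open>h\<close> first leaves
  \<open>card H\<close> for each \<open>u\<close> in the dual; summing over \<open>u\<close> first
  leaves only \<open>h = 0\<close>, since the product is nondegenerate.\<close>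

lemma card_perp:
  assumes "subgrp H" "H \<subseteq> mixed \<alpha> \<beta>"
  shows "card H * card (perp \<alpha> \<beta> H) = card (mixed \<alpha> \<beta>)"
proof -
  note fin = card_mixed(1)[of \<alpha> \<beta>]
  have finH: "finite H" using fin assms(2) by (rule finite_subset[rotated])
  have "(\<Sum>u\<in>mixed \<alpha> \<beta>. \<Sum>h\<in>H. chi (ip \<alpha> \<beta> u h)) =
        (\<Sum>u\<in>mixed \<alpha> \<beta>. if u \<in> perp \<alpha> \<beta> H then of_nat (card H) else 0)"
    by (rule sum.cong) (auto simp: sum_chi[OF assms(1) additive_ip] perp_def)
  also have "\<dots> = (\<Sum>u\<in>perp \<alpha> \<beta> H. of_nat (card H))"
    by (rule sum.mono_neutral_cong_right[OF fin perp_subset]) auto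
  also have "\<dots> = of_nat (card H * card (perp \<alpha> \<beta> H))" by (simp add: mult.commute)
  finally have 1: "(\<Sum>u\<in>mixed \<alpha> \<beta>. \<Sum>h\<in>H. chi (ip \<alpha> \<beta> u h)) = of_nat (card H * card (perp \<alpha> \<beta> H))" .
  have "(\<Sum>h\<in>H. \<Sum>u\<in>mixed \<alpha> \<beta>. chi (ip \<alpha> \<beta> u h)) = (\<Sum>h\<in>H. if h = 0 then of_nat (card (mixed \<alpha> \<beta>)) else 0)"
  proof (rule sum.cong)
    fix h assume h: "h \<in> H"
    have "(\<Sum>u\<in>mixed \<alpha> \<beta>. chi (ip \<alpha> \<beta> u h)) =
      (if \<forall>u\<in>mixed \<alpha> \<beta>. ip \<alpha> \<beta> h u = 0 then of_nat (card (mixed \<alpha> \<beta>)) else 0)"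
      using sum_chi[OF subgrp_mixed[of \<alpha> \<beta>] additive_ip[of _ \<alpha> \<beta> h]] by (simp add: ip_commute)
    moreover have "(\<forall>u\<in>mixed \<alpha> \<beta>. ip \<alpha> \<beta> h u = 0) \<longleftrightarrow> h = 0"
      using ip_nondegenerate[of h \<alpha> \<beta>] h assms(2) by (auto simp: ip_0)
    ultimately show "(\<Sum>u\<in>mixed \<alpha> \<beta>. chi (ip \<alpha> \<beta> u h)) = (if h = 0 then of_nat (card (mixed \<alpha> \<beta>)) else 0)"
      by simp
  qed simp
  also have "\<dots> = of_nat (card (mixed \<alpha> \<beta>))"
    using finH subgrpD(1)[OF assms(1)] by simp
  finally have 2: "(\<Sum>h\<in>H. \<Sum>u\<in>mixed \<alpha> \<beta>. chi (ip \<alpha> \<beta> u h)) = of_nat (card (mixed \<alpha> \<beta>))" .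
  have "of_nat (card H * card (perp \<alpha> \<beta> H)) = (of_nat (card (mixed \<alpha> \<beta>)) :: complex)"
    unfolding 1[symmetric] 2[symmetric] by (rule sum.swap)
  thus ?thesis by (simp only: of_nat_eq_iff)
qed

text \<open>One inclusion is immediate; equality follows since \<open>card_perp\<close>, used for
  \<open>H\<close> and for its dual, gives both sides the same order.\<close>

lemma perp_perp:
  assumes "subgrp H" "H \<subseteq> mixed \<alpha> \<beta>"
  shows "perp \<alpha> \<beta> (perp \<alpha> \<beta> H) = H"
proof -
  have sub: "H \<subseteq> perp \<alpha> \<beta> (perp \<alpha> \<beta> H)" using assms(2) by (auto simp: perp_def ip_commute)
  have "card H * card (perp \<alpha> \<beta> H) = card (perp \<alpha> \<beta> H) * card (perp \<alpha> \<beta> (perp \<alpha> \<beta> H))"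
    using card_perp[OF assms] card_perp[OF subgrp_perp perp_subset] by simp
  moreover have "card (perp \<alpha> \<beta> H) > 0"
    using card_perp[OF assms] card_mixed(2)[of \<alpha> \<beta>] by (metis mult_is_0 neq0_conv power_not_zero zero_neq_numeral)
  ultimately have "card H = card (perp \<alpha> \<beta> (perp \<alpha> \<beta> H))" by (simp add: mult.commute)
  thus ?thesis using sub card_subset_eq finite_subset[OF perp_subset card_mixed(1)] by metis
qed

section \<open>Extended perfect codes\<close>

text \<open>The Lee weight, that is, the Hamming weight of the image under
  \<open>gray4\<close>.\<close>

definition lee :: "4 \<Rightarrow> nat" where
  "lee x = (if x = 0 then 0 else if x = 2 then 2 else 1)"

definition wt :: "nat \<Rightarrow> nat \<Rightarrow> (nat \<Rightarrow> bit) \<times> (nat \<Rightarrow> 4) \<Rightarrow> nat" where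
  "wt \<alpha> \<beta> u = (\<Sum>i<\<alpha>. if fst u i = 0 then 0 else 1) + (\<Sum>j<\<beta>. lee (snd u j))"

text \<open>The vectors of weight one. A quaternary position contributes two of them, just as it
  contributes two binary coordinates to the Gray image.\<close>

definition units :: "nat \<Rightarrow> nat \<Rightarrow> ((nat \<Rightarrow> bit) \<times> (nat \<Rightarrow> 4)) set" where
  "units \<alpha> \<beta> = unit2 ` {..<\<alpha>} \<union> (unit4 1 ` {..<\<beta>} \<union> unit4 3 ` {..<\<beta>})"

text \<open>The Gray image of this vector is the all-ones vector. Its inner product with
  \<open>u\<close> is twice the weight of \<open>u\<close> modulo 4, so it detects the parity of the
  weight.\<close>

definition ones :: "nat \<Rightarrow> nat \<Rightarrow> (nat \<Rightarrow> bit) \<times> (nat \<Rightarrow> 4)" where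
  "ones \<alpha> \<beta> = ((\<lambda>i. if i < \<alpha> then 1 else 0), (\<lambda>j. if j < \<beta> then 2 else 0))"

lemma wt_add: "wt \<alpha> \<beta> (u + v) \<le> wt \<alpha> \<beta> u + wt \<alpha> \<beta> v"
proof -
  have a: "lee (x + y) \<le> lee x + lee y" for x y
    using cases_4[of x] cases_4[of y] by (elim disjE) (simp_all add: lee_def)
  have b: "(if x + y = (0::bit) then 0 else 1::nat) \<le> (if x = 0 then 0 else 1) + (if y = 0 then 0 else 1)"
    for x y by auto
  have "(\<Sum>i<\<alpha>. if fst (u + v) i = 0 then 0 else 1::nat) \<le>
      (\<Sum>i<\<alpha>. if fst u i = 0 then 0 else 1) + (\<Sum>i<\<alpha>. if fst v i = 0 then 0 else 1)"
    unfolding sum.distrib[symmetric] by (rule sum_mono) (use b in simp)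
  moreover have "(\<Sum>j<\<beta>. lee (snd (u + v) j)) \<le> (\<Sum>j<\<beta>. lee (snd u j)) + (\<Sum>j<\<beta>. lee (snd v j))"
    unfolding sum.distrib[symmetric] by (rule sum_mono) (use a in simp)
  ultimately show ?thesis unfolding wt_def by linarith
qed

lemma wt_uminus: "wt \<alpha> \<beta> (- u) = wt \<alpha> \<beta> u"
proof -
  have "lee (- x) = lee x" for x
    using cases_4[of x] by (elim disjE) (simp_all add: lee_def arith_4)
  thus ?thesis by (simp add: wt_def)
qed

lemma wt_diff: "wt \<alpha> \<beta> (u - v) \<le> wt \<alpha> \<beta> u + wt \<alpha> \<beta> v"
  using wt_add[of \<alpha> \<beta> u "- v"] by (simp add: wt_uminus)

lemma wt_unit4: "j < \<beta> \<Longrightarrow> wt \<alpha> \<beta> (unit4 c j) = lee c"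
proof -
  assume "j < \<beta>"
  have "lee (if k = j then c else 0) = (if k = j then lee c else 0)" for k
    by (auto simp: lee_def)
  thus ?thesis using \<open>j < \<beta>\<close> by (simp add: wt_def unit4_def)
qed

lemma wt_unit: "e \<in> units \<alpha> \<beta> \<Longrightarrow> wt \<alpha> \<beta> e = 1"
proof -
  have "wt \<alpha> \<beta> (unit2 i) = 1" if "i < \<alpha>" for i
  proof -
    have "(if (if k = i then 1 else 0) = (0::bit) then 0 else 1) = (if k = i then 1 else 0 :: nat)" for k
      by auto
    thus ?thesis using that by (simp only: wt_def unit2_def fst_conv snd_conv) (simp add: lee_def)
  qed
  moreover assume "e \<in> units \<alpha> \<beta>"
  ultimately show ?thesis by (auto simp: units_def wt_unit4 lee_def)
qed

lemma units_mixed: "units \<alpha> \<beta> \<subseteq> mixed \<alpha> \<beta>"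
  by (auto simp: units_def unit_mixed)

lemma uminus_units: "e \<in> units \<alpha> \<beta> \<Longrightarrow> - e \<in> units \<alpha> \<beta>"
proof -
  have "- unit2 i = unit2 i" for i by (simp add: unit2_def prod_eq_iff fun_eq_iff)
  moreover have "- unit4 1 j = unit4 3 j" "- unit4 3 j = unit4 1 j" for j
    by (auto simp: unit4_def prod_eq_iff fun_eq_iff arith_4)
  moreover assume "e \<in> units \<alpha> \<beta>"
  ultimately show ?thesis by (auto simp: units_def)
qed

lemma card_units: "finite (units \<alpha> \<beta>)" "card (units \<alpha> \<beta>) = \<alpha> + 2 * \<beta>"
proof -
  show "finite (units \<alpha> \<beta>)" by (simp add: units_def)
  have i2: "i = k" if "unit2 i = unit2 k" for i k
    using arg_cong[OF that, of "\<lambda>u. fst u i"] by (simp add: unit2_def split: if_splits)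
  have i4: "c = c' \<and> j = k" if "c \<noteq> 0" "unit4 c j = unit4 c' k" for c c' j k
    using that(1) arg_cong[OF that(2), of "\<lambda>u. snd u j"] by (simp add: unit4_def split: if_splits)
  have i24: "unit2 i \<noteq> unit4 c j" for i j c
  proof
    assume "unit2 i = unit4 c j"
    from arg_cong[OF this, of "\<lambda>u. fst u i"] show False by (simp add: unit2_def unit4_def)
  qed
  have "unit4 1 ` {..<\<beta>} \<inter> unit4 3 ` {..<\<beta>} = {}"
  proof -
    have "unit4 1 j \<noteq> unit4 3 k" for j k using i4[of 1 j 3 k] by auto
    thus ?thesis by blast
  qed
  moreover have "unit2 ` {..<\<alpha>} \<inter> (unit4 1 ` {..<\<beta>} \<union> unit4 3 ` {..<\<beta>}) = {}" using i24 by blast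
  ultimately have "card (units \<alpha> \<beta>) = card (unit2 ` {..<\<alpha>}) + (card (unit4 1 ` {..<\<beta>}) + card (unit4 3 ` {..<\<beta>}))"
    unfolding units_def by (simp add: card_Un_disjoint)
  moreover have "card (unit2 ` {..<\<alpha>}) = \<alpha>" by (subst card_image) (auto intro!: inj_onI dest: i2)
  moreover have "card (unit4 c ` {..<\<beta>}) = \<beta>" if "c \<noteq> 0" for c
    using that by (subst card_image) (auto intro!: inj_onI dest: i4)
  ultimately show "card (units \<alpha> \<beta>) = \<alpha> + 2 * \<beta>" by simp
qed

lemma ones_mixed: "ones \<alpha> \<beta> \<in> mixed \<alpha> \<beta>"
  by (auto simp: ones_def mixed_def supported_def)

lemma ip_ones_unit: "e \<in> units \<alpha> \<beta> \<Longrightarrow> ip \<alpha> \<beta> (ones \<alpha> \<beta>) e = 2"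
  by (auto simp: units_def ip_unit2 ip_unit4 ones_def arith_4)

text \<open>A nonzero vector becomes lighter after subtraction of a suitable unit vector; hence unit
  steps from 0 reach every vector.\<close>

lemma mixed_units_induct:
  assumes "P 0" and step: "\<And>x e. x \<in> mixed \<alpha> \<beta> \<Longrightarrow> e \<in> units \<alpha> \<beta> \<Longrightarrow> P x \<Longrightarrow> P (x + e)"
    and "x \<in> mixed \<alpha> \<beta>"
  shows "P x"
  using assms(3)
proof (induction "wt \<alpha> \<beta> x" arbitrary: x rule: less_induct)
  case less
  show ?case
  proof (cases "x = 0")
    case False
    have "\<exists>e\<in>units \<alpha> \<beta>. wt \<alpha> \<beta> (x - e) < wt \<alpha> \<beta> x"
    proof (cases "\<exists>i<\<alpha>. fst x i \<noteq> 0")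
      case True
      then obtain i where i: "i < \<alpha>" "fst x i \<noteq> 0" by blast
      have "(\<Sum>k<\<alpha>. if fst (x - unit2 i) k = 0 then 0 else 1::nat) < (\<Sum>k<\<alpha>. if fst x k = 0 then 0 else 1)"
        by (rule sum_strict_mono_ex1) (use i in \<open>auto simp: unit2_def intro!: bexI[of _ i]\<close>)
      moreover have "snd (x - unit2 i) = snd x" by (simp add: unit2_def)
      ultimately have "wt \<alpha> \<beta> (x - unit2 i) < wt \<alpha> \<beta> x" by (simp add: wt_def)
      thus ?thesis using i by (intro bexI[of _ "unit2 i"]) (auto simp: units_def)
    next
      case no: False
      have "\<exists>j<\<beta>. snd x j \<noteq> 0"
      proof (rule ccontr)
        assume "\<not> ?thesis"
        hence "fst x k = 0" "snd x k = 0" for k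
          using no less.prems by (auto simp: mixed_def supported_def mem_Times_iff not_less[symmetric])
        thus False using False by (simp add: prod_eq_iff fun_eq_iff)
      qed
      then obtain j where j: "j < \<beta>" "snd x j \<noteq> 0" by blast
      \<comment> \<open>Subtracting 1 lowers the Lee weight of 1 and of 2; the entry 3 needs 3
        instead.\<close>
      obtain c where c: "c \<in> {1, 3}" "lee (snd x j - c) < lee (snd x j)"
      proof (cases "snd x j = 3")
        case True thus thesis by (intro that[of 3]) (auto simp: lee_def)
      next
        case False thus thesis using cases_4[of "snd x j"] j by (intro that[of 1]) (auto simp: lee_def)
      qed
      have "(\<Sum>k<\<beta>. lee (snd (x - unit4 c j) k)) < (\<Sum>k<\<beta>. lee (snd x k))"
        by (rule sum_strict_mono_ex1) (use j c in \<open>auto simp: unit4_def intro!: bexI[of _ j]\<close>)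
      moreover have "fst (x - unit4 c j) = fst x" by (simp add: unit4_def fun_eq_iff)
      ultimately have "wt \<alpha> \<beta> (x - unit4 c j) < wt \<alpha> \<beta> x" by (simp add: wt_def)
      thus ?thesis using c j by (intro bexI[of _ "unit4 c j"]) (auto simp: units_def)
    qed
    then obtain e where e: "e \<in> units \<alpha> \<beta>" "wt \<alpha> \<beta> (x - e) < wt \<alpha> \<beta> x" by blast
    have "x - e \<in> mixed \<alpha> \<beta>" using less.prems e units_mixed subgrpD(4)[OF subgrp_mixed] by blast
    from step[OF this e(1) less.hyps[OF e(2) this]] show ?thesis by simp
  qed (use assms(1) in simp)
qed

text \<open>With \<open>n\<close> for the length \<open>\<alpha> + 2 * \<beta>\<close>, the
  assumption \<open>card_C\<close> says without division that the code has
  \<open>2 ^ n / (2 * n)\<close> elements. For a subgroup, minimum distance 4 is a condition on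
  weights.\<close>

locale extended_perfect_code =
  fixes \<alpha> \<beta> :: nat and C :: "((nat \<Rightarrow> bit) \<times> (nat \<Rightarrow> 4)) set"
  assumes subgrp: "subgrp C" and C_mixed: "C \<subseteq> mixed \<alpha> \<beta>"
    and card_C: "card C * (2 * (\<alpha> + 2 * \<beta>)) = 2 ^ (\<alpha> + 2 * \<beta>)"
    and wt_ge_4: "c \<in> C \<Longrightarrow> c \<noteq> 0 \<Longrightarrow> wt \<alpha> \<beta> c \<ge> 4"
begin

lemma notin_C: "x \<noteq> 0 \<Longrightarrow> wt \<alpha> \<beta> x \<le> 3 \<Longrightarrow> x \<notin> C"
  using wt_ge_4[of x] by linarith

section \<open>The vectors at distance one from the code are those of odd weight\<close>

definition nbrs :: "((nat \<Rightarrow> bit) \<times> (nat \<Rightarrow> 4)) set" where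
  "nbrs = (\<lambda>(c, e). c + e) ` (C \<times> units \<alpha> \<beta>)"

lemma nbrs_mixed: "nbrs \<subseteq> mixed \<alpha> \<beta>"
proof
  fix x assume "x \<in> nbrs"
  then obtain c e where "c \<in> C" "e \<in> units \<alpha> \<beta>" "x = c + e" by (auto simp: nbrs_def)
  thus "x \<in> mixed \<alpha> \<beta>" using C_mixed units_mixed subgrpD(2)[OF subgrp_mixed] by blast
qed

text \<open>The sums \<open>c + e\<close> are pairwise distinct: two equal ones would make a
  difference of unit vectors, of weight at most 2, a codeword. The count is then
  \<open>card C\<close> times the length.\<close>

lemma card_nbrs: "2 * card nbrs = card (mixed \<alpha> \<beta>)"
proof -
  have "inj_on (\<lambda>(c, e). c + e) (C \<times> units \<alpha> \<beta>)"
  proof (rule inj_onI)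
    fix p q assume pq: "p \<in> C \<times> units \<alpha> \<beta>" "q \<in> C \<times> units \<alpha> \<beta>"
      "(\<lambda>(c, e). c + e) p = (\<lambda>(c, e). c + e) q"
    obtain c e c' e' where p: "p = (c, e)" and q: "q = (c', e')" by (cases p, cases q) blast
    have *: "c \<in> C" "c' \<in> C" "e \<in> units \<alpha> \<beta>" "e' \<in> units \<alpha> \<beta>" "c + e = c' + e'"
      using pq by (simp_all add: p q)
    have "e' - e = c - c'" using *(5) by (simp only: algebra_simps)
    hence "e' - e \<in> C" using subgrpD(4)[OF subgrp *(1,2)] by simp
    moreover have "wt \<alpha> \<beta> (e' - e) \<le> 3"
      using wt_diff[of \<alpha> \<beta> e' e] wt_unit[OF *(3)] wt_unit[OF *(4)] by linarith
    ultimately have "e' - e = 0" using notin_C[of "e' - e"] by blast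
    thus "p = q" using *(5) by (simp add: p q)
  qed
  hence "card nbrs = card C * (\<alpha> + 2 * \<beta>)"
    unfolding nbrs_def by (subst card_image) (auto simp: card_cartesian_product card_units)
  thus ?thesis using card_C by (simp add: card_mixed mult_ac)
qed

text \<open>Two elements of \<open>nbrs\<close> never differ by a unit vector. A translate of
  \<open>nbrs\<close> by a unit vector is thus disjoint from it, and as each fills half of the
  space, it is the complement.\<close>

lemma nbrs_step:
  assumes "x \<in> mixed \<alpha> \<beta>" "e \<in> units \<alpha> \<beta>"
  shows "x + e \<in> nbrs \<longleftrightarrow> x \<notin> nbrs"
proof -
  have no: "x + e \<notin> nbrs" if "x \<in> nbrs" "e \<in> units \<alpha> \<beta>" for x e
  proof
    assume "x + e \<in> nbrs"
    then obtain c2 e2 where 2: "c2 \<in> C" "e2 \<in> units \<alpha> \<beta>" "x + e = c2 + e2" by (auto simp: nbrs_def)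
    from that obtain c1 e1 where 1: "c1 \<in> C" "e1 \<in> units \<alpha> \<beta>" "x = c1 + e1" by (auto simp: nbrs_def)
    have "e1 + e - e2 = c2 - c1" using 1 2 by (simp add: algebra_simps)
    hence inC: "e1 + e - e2 \<in> C" using subgrpD(4)[OF subgrp 2(1) 1(1)] by simp
    have "wt \<alpha> \<beta> (e1 + e - e2) \<le> 3"
      using wt_diff[of \<alpha> \<beta> "e1 + e" e2] wt_add[of \<alpha> \<beta> e1 e] wt_unit[OF 1(2)] wt_unit[OF 2(2)]
        wt_unit[OF that(2)] by linarith
    hence "e1 + e - e2 = 0" using notin_C inC by blast
    \<comment> \<open>The weight bound alone does not exclude that the three unit vectors cancel.
      The product with \<open>ones\<close> does: it is 2 + 2 - 2, which is nonzero.\<close>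
    moreover have "ip \<alpha> \<beta> (ones \<alpha> \<beta>) (e1 + e - e2) = 2"
      using 1(2) 2(2) that(2) by (simp add: ip_diff_right ip_add_right ip_ones_unit)
    ultimately show False by (simp add: ip_0)
  qed
  have "x + e \<in> nbrs" if "x \<notin> nbrs"
  proof -
    \<comment> \<open>Membership of \<open>x\<close> in \<open>S\<close> means that
      \<open>x + e\<close> lies in \<open>nbrs\<close>.\<close>
    define S where "S = (\<lambda>y. y + - e) ` nbrs"
    have ue: "- e \<in> units \<alpha> \<beta>" using assms(2) by (rule uminus_units)
    have "S \<subseteq> mixed \<alpha> \<beta>"
      using nbrs_mixed units_mixed ue subgrpD(2)[OF subgrp_mixed] unfolding S_def by blast
    have "card S = card nbrs" unfolding S_def by (rule card_image) (auto simp: inj_on_def)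
    have "finite nbrs" using nbrs_mixed card_mixed(1) by (rule finite_subset)
    hence "finite S" by (simp add: S_def)
    have "nbrs \<inter> S = {}" using no[OF _ ue] unfolding S_def by blast
    hence "card (nbrs \<union> S) = card (mixed \<alpha> \<beta>)"
      using card_Un_disjoint[OF \<open>finite nbrs\<close> \<open>finite S\<close>] \<open>card S = _\<close> card_nbrs by simp
    hence "nbrs \<union> S = mixed \<alpha> \<beta>"
      using nbrs_mixed \<open>S \<subseteq> _\<close> card_mixed(1) by (intro card_subset_eq) auto
    with assms(1) that obtain y where "y \<in> nbrs" "x = y + - e" by (auto simp: S_def)
    thus ?thesis by simp
  qed
  with no assms(2) show ?thesis by blast
qed

text \<open>Both sides are 0 at the zero vector and switch between 0 and 2 at every unit
  step.\<close>

lemma parity: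
  assumes "x \<in> mixed \<alpha> \<beta>"
  shows "ip \<alpha> \<beta> (ones \<alpha> \<beta>) x = (if x \<in> nbrs then 2 else 0)"
  using _ _ assms
proof (rule mixed_units_induct)
  have "0 \<notin> nbrs"
  proof
    assume "0 \<in> nbrs"
    then obtain c e where ce: "c \<in> C" "e \<in> units \<alpha> \<beta>" "c + e = 0" by (auto simp: nbrs_def)
    have "e = - c" using ce(3) by (simp add: eq_neg_iff_add_eq_0 add.commute)
    hence "e \<in> C" using ce(1) subgrpD(3)[OF subgrp] by simp
    moreover have "e \<noteq> 0" using ip_ones_unit[OF ce(2)] by (auto simp: ip_0)
    ultimately show False using notin_C[of e] wt_unit[OF ce(2)] by simp
  qed
  thus "ip \<alpha> \<beta> (ones \<alpha> \<beta>) 0 = (if 0 \<in> nbrs then 2 else 0)" by (simp add: ip_0)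
next
  fix x e assume "x \<in> mixed \<alpha> \<beta>" "e \<in> units \<alpha> \<beta>"
    "ip \<alpha> \<beta> (ones \<alpha> \<beta>) x = (if x \<in> nbrs then 2 else 0)"
  thus "ip \<alpha> \<beta> (ones \<alpha> \<beta>) (x + e) = (if x + e \<in> nbrs then 2 else 0)"
    by (simp add: ip_add_right ip_ones_unit nbrs_step arith_4)
qed

text \<open>A codeword in \<open>nbrs\<close> would differ from another codeword by a unit vector,
  which is too light to be in the code. So codewords have even weight.\<close>

lemma ones_in_perp: "ones \<alpha> \<beta> \<in> perp \<alpha> \<beta> C"
proof -
  have "ip \<alpha> \<beta> (ones \<alpha> \<beta>) c = 0" if c: "c \<in> C" for c
  proof -
    have "c \<notin> nbrs"
    proof
      assume "c \<in> nbrs"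
      then obtain d e where de: "d \<in> C" "e \<in> units \<alpha> \<beta>" "c = d + e" by (auto simp: nbrs_def)
      hence "e \<in> C" using subgrpD(4)[OF subgrp c de(1)] by simp
      moreover have "e \<noteq> 0" using ip_ones_unit[OF de(2)] by (auto simp: ip_0)
      ultimately show False using notin_C[of e] wt_unit[OF de(2)] by simp
    qed
    moreover have "c \<in> mixed \<alpha> \<beta>" using c C_mixed by blast
    ultimately show ?thesis using parity[of c] by simp
  qed
  thus ?thesis by (simp add: perp_def ones_mixed)
qed

section \<open>Consequences for the dual code\<close>

lemma unit4_2_notin: "j < \<beta> \<Longrightarrow> unit4 2 j \<notin> C"
proof (rule notin_C)
  assume "j < \<beta>"
  show "unit4 2 j \<noteq> 0" by (auto simp: unit4_def zero_prod_def fun_eq_iff)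
  show "wt \<alpha> \<beta> (unit4 2 j) \<le> 3" using \<open>j < \<beta>\<close> by (simp add: wt_unit4 lee_def)
qed

text \<open>If the coordinate were even on the whole dual, then \<open>unit4 2 j\<close> would be
  orthogonal to the dual, hence a codeword by double duality, although its weight is 2.\<close>

lemma perp_odd_coordinate:
  assumes "j < \<beta>"
  shows "\<exists>d\<in>perp \<alpha> \<beta> C. snd d j + snd d j \<noteq> 0"
proof (rule ccontr)
  assume "\<not> ?thesis"
  hence "ip \<alpha> \<beta> (unit4 2 j) d = 0" if "d \<in> perp \<alpha> \<beta> C" for d
    using that assms by (simp add: ip_commute[of _ _ "unit4 2 j"] ip_unit4 mult_2_right)
  hence "unit4 2 j \<in> perp \<alpha> \<beta> (perp \<alpha> \<beta> C)"
    using assms by (subst perp_def) (simp add: unit_mixed)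
  thus False using perp_perp[OF subgrp C_mixed] unit4_2_notin[OF assms] by simp
qed

text \<open>By double duality for \<open>dbl ?D\<close> it suffices that \<open>d\<close> is
  orthogonal to the dual of \<open>dbl ?D\<close>. Moving the factor 2 across the product shows that
  each \<open>u\<close> in that dual satisfies \<open>u + u \<in> C\<close>.\<close>

lemma perp_binary_zero:
  assumes "\<alpha> \<noteq> 0" "d \<in> perp \<alpha> \<beta> C" "fst d = 0"
  shows "d \<in> dbl (perp \<alpha> \<beta> C)"
proof -
  let ?D = "perp \<alpha> \<beta> C"
  have dd: "perp \<alpha> \<beta> ?D = C" by (rule perp_perp[OF subgrp C_mixed])
  have dbl_mixed: "dbl ?D \<subseteq> mixed \<alpha> \<beta>"
    using perp_subset[of \<alpha> \<beta> C] subgrpD(2)[OF subgrp_mixed] unfolding dbl_def by blast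
  have binary: "ip \<alpha> \<beta> d (unit2 i) = 0" if "i < \<alpha>" for i
    using that assms(3) by (simp add: ip_unit2)
  \<comment> \<open>An odd \<open>u\<close> is \<open>c + e\<close> with a codeword
    \<open>c\<close>. The double of \<open>e\<close> is a codeword too, so \<open>e\<close> is not
    quaternary, and \<open>d\<close> is orthogonal to both summands.\<close>
  have odd: "ip \<alpha> \<beta> d u = 0"
    if u: "u \<in> mixed \<alpha> \<beta>" "u + u \<in> C" "ip \<alpha> \<beta> (ones \<alpha> \<beta>) u \<noteq> 0" for u
  proof -
    from parity[OF u(1)] u(3) have "u \<in> nbrs" by (simp split: if_splits)
    then obtain c e where ce: "c \<in> C" "e \<in> units \<alpha> \<beta>" "u = c + e" by (auto simp: nbrs_def)
    have "e + e = (u + u) - (c + c)" using ce(3) by (simp add: algebra_simps)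
    hence "e + e \<in> C" using u(2) ce(1) subgrpD[OF subgrp] by simp
    have "e \<notin> unit4 x ` {..<\<beta>}" if "x \<in> {1, 3}" for x
    proof
      assume "e \<in> unit4 x ` {..<\<beta>}"
      then obtain j where j: "j < \<beta>" "e = unit4 x j" by auto
      hence "e + e = unit4 2 j" using that by (auto simp: unit4_def fun_eq_iff arith_4)
      with \<open>e + e \<in> C\<close> unit4_2_notin[OF j(1)] show False by simp
    qed
    with ce(2) obtain i where "i < \<alpha>" "e = unit2 i" by (auto simp: units_def)
    hence "ip \<alpha> \<beta> d e = 0" using binary by simp
    moreover have "ip \<alpha> \<beta> d c = 0" using assms(2) ce(1) by (auto simp: perp_def)
    ultimately show ?thesis using ce(3) by (simp add: ip_add_right)
  qed
  have "ip \<alpha> \<beta> d u = 0" if u: "u \<in> perp \<alpha> \<beta> (dbl ?D)" for u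
  proof -
    have um: "u \<in> mixed \<alpha> \<beta>" using u by (auto simp: perp_def)
    have "ip \<alpha> \<beta> (u + u) v = 0" if "v \<in> ?D" for v
    proof -
      have "v + v \<in> dbl ?D" using that by (auto simp: dbl_def)
      hence "ip \<alpha> \<beta> u (v + v) = 0" using u unfolding perp_def by blast
      thus ?thesis by (simp add: ip_add_left ip_add_right)
    qed
    hence uu: "u + u \<in> C"
      using um subgrpD(2)[OF subgrp_mixed] by (subst dd[symmetric], subst perp_def) auto
    show ?thesis
    proof (cases "ip \<alpha> \<beta> (ones \<alpha> \<beta>) u = 0")
      case False
      with odd[OF um uu] show ?thesis .
    next
      case True
      \<comment> \<open>Adding a binary unit vector flips the parity of \<open>u\<close> but changes
        neither its double nor its product with \<open>d\<close>. Such a vector exists because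
        \<open>\<alpha> \<noteq> 0\<close>.\<close>
      let ?e = "unit2 0"
      have e: "0 < \<alpha>" "?e \<in> units \<alpha> \<beta>" using assms(1) by (auto simp: units_def)
      have "?e + ?e = 0" using cases_bit by (auto simp: unit2_def zero_prod_def fun_eq_iff)
      hence eq: "(u + ?e) + (u + ?e) = u + u" by (simp add: algebra_simps)
      have "(u + ?e) + (u + ?e) \<in> C" unfolding eq by (rule uu)
      moreover have "u + ?e \<in> mixed \<alpha> \<beta>"
        using um e(2) subgrpD(2)[OF subgrp_mixed] units_mixed by blast
      moreover have "ip \<alpha> \<beta> (ones \<alpha> \<beta>) (u + ?e) \<noteq> 0"
        using True e(2) by (simp add: ip_add_right ip_ones_unit)
      ultimately have "ip \<alpha> \<beta> d (u + ?e) = 0" by (intro odd)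
      thus ?thesis using binary[OF e(1)] by (simp add: ip_add_right)
    qed
  qed
  hence "d \<in> perp \<alpha> \<beta> (perp \<alpha> \<beta> (dbl ?D))"
    using assms(2) perp_subset by (subst perp_def) blast
  thus ?thesis using perp_perp[OF subgrp_dbl[OF subgrp_perp] dbl_mixed] by simp
qed

end

section \<open>Sums of subgroups and the type of the intersection\<close>

text \<open>Written as an image of the product so that \<open>card_image_kernel\<close> applies to
  the addition map.\<close>

definition subgrp_plus :: "'a::ab_group_add set \<Rightarrow> 'a set \<Rightarrow> 'a set" where
  "subgrp_plus A B = (\<lambda>p. fst p + snd p) ` (A \<times> B)"

lemma additive_plus: "additive_on H (\<lambda>p. fst p + snd p)"
  by (simp add: additive_on_def algebra_simps)

lemma subgrp_plus:
  assumes "subgrp A" "subgrp B"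
  shows "subgrp (subgrp_plus A B)" "A \<subseteq> subgrp_plus A B" "B \<subseteq> subgrp_plus A B"
proof -
  show "subgrp (subgrp_plus A B)"
    unfolding subgrp_plus_def by (intro subgrp_image subgrp_Times assms additive_plus)
  show "A \<subseteq> subgrp_plus A B"
    using subgrpD(1)[OF assms(2)] by (force simp: subgrp_plus_def)
  show "B \<subseteq> subgrp_plus A B"
    using subgrpD(1)[OF assms(1)] by (force simp: subgrp_plus_def)
qed

lemma dbl_plus: "dbl (subgrp_plus A B) = subgrp_plus (dbl A) (dbl B)"
proof -
  have e: "a + b + (a + b) = (a + a) + (b + b)" for a b :: 'a by (simp add: algebra_simps)
  show ?thesis
  proof
    show "dbl (subgrp_plus A B) \<subseteq> subgrp_plus (dbl A) (dbl B)"
    proof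
      fix x assume "x \<in> dbl (subgrp_plus A B)"
      then obtain a b where "a \<in> A" "b \<in> B" "x = a + b + (a + b)"
        by (auto simp: dbl_def subgrp_plus_def)
      thus "x \<in> subgrp_plus (dbl A) (dbl B)"
        unfolding e subgrp_plus_def dbl_def by (intro image_eqI[of _ _ "(a + a, b + b)"]) auto
    qed
    show "subgrp_plus (dbl A) (dbl B) \<subseteq> dbl (subgrp_plus A B)"
    proof
      fix x assume "x \<in> subgrp_plus (dbl A) (dbl B)"
      then obtain a b where ab: "a \<in> A" "b \<in> B" "x = (a + a) + (b + b)"
        by (auto simp: dbl_def subgrp_plus_def)
      have "a + b \<in> subgrp_plus A B"
        unfolding subgrp_plus_def by (rule image_eqI[of _ _ "(a, b)"]) (simp_all add: ab)
      moreover have "x = (a + b) + (a + b)" unfolding e by (rule ab(3))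
      ultimately show "x \<in> dbl (subgrp_plus A B)" unfolding dbl_def by (rule rev_image_eqI)
    qed
  qed
qed

text \<open>The torsion of the sum has the order of the sum modulo its doubles, which is the index
  of \<open>K\<close> in \<open>A \<times> B\<close>. The torsion orders of \<open>A\<close> and
  \<open>B\<close> multiply to the index of the smaller group \<open>L\<close>. The element
  \<open>(w, w)\<close> lies in \<open>K\<close> but not in \<open>L\<close>, and this gives the
  factor 2.\<close>

lemma card_tors_plus:
  assumes sub: "subgrp A" "subgrp B" and fin: "finite A" "finite B"
    and w: "w \<in> A" "w \<in> B" "w \<notin> dbl A"
  shows "2 * card (tors (subgrp_plus A B)) \<le> card (tors A) * card (tors B)"
proof -
  define s where "s = (\<lambda>p :: 'a \<times> 'a. fst p + snd p)"
  define D where "D = subgrp_plus A B"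
  define K where "K = {p \<in> A \<times> B. s p \<in> dbl D}"
  define L where "L = dbl A \<times> dbl B"
  have D: "D = s ` (A \<times> B)" by (simp add: D_def s_def subgrp_plus_def)
  have sD: "subgrp D" "A \<subseteq> D" "B \<subseteq> D" unfolding D_def by (rule subgrp_plus[OF sub])+
  have finP: "finite (A \<times> B)" using fin by simp
  hence finD: "finite D" by (simp add: D)
  have sP: "subgrp (A \<times> B)" using sub by (rule subgrp_Times)
  have add: "additive_on H s" for H unfolding s_def by (rule additive_plus)
  have s_add: "s (p + q) = s p + s q" for p q by (simp add: s_def algebra_simps)
  have s_minus: "s (- p) = - s p" for p by (simp add: s_def)
  have s_0: "s 0 = 0" by (simp add: s_def)
  note sdD = subgrp_dbl[OF sD(1)]
  have sK: "subgrp K"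
    unfolding subgrp_def
  proof (intro conjI ballI)
    show "0 \<in> K" using subgrpD(1)[OF sP] subgrpD(1)[OF sdD] by (simp add: K_def s_0)
    fix x assume x: "x \<in> K"
    thus "- x \<in> K" using subgrpD(3)[OF sP, of x] subgrpD(3)[OF sdD, of "s x"] by (simp add: K_def s_minus)
    fix y assume "y \<in> K"
    with x show "x + y \<in> K"
      using subgrpD(2)[OF sP, of x y] subgrpD(2)[OF sdD, of "s x" "s y"] by (simp add: K_def s_add)
  qed
  have finK: "finite K" using finP by (simp add: K_def)
  have "dbl D \<subseteq> D" using subgrpD(2)[OF sD(1)] by (auto simp: dbl_def)
  hence "s ` K = dbl D" unfolding K_def D by blast
  moreover have "{p \<in> K. s p = 0} = {p \<in> A \<times> B. s p = 0}"
    unfolding K_def using subgrpD(1)[OF sdD] by auto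
  ultimately have cK: "card K = card (dbl D) * card {p \<in> A \<times> B. s p = 0}"
    using card_image_kernel[OF sK add finK] by simp
  have "card (A \<times> B) = card D * card {p \<in> A \<times> B. s p = 0}"
    using card_image_kernel[OF sP add finP] by (simp add: D)
  also have "card D = card (dbl D) * card (tors D)" by (rule card_dbl_tors[OF sD(1) finD])
  \<comment> \<open>The maps from \<open>A \<times> B\<close> onto \<open>D\<close> and from
    \<open>K\<close> onto \<open>dbl D\<close> have the same kernel, which cancels.\<close>
  finally have cP: "card (A \<times> B) = card (tors D) * card K" by (simp add: cK mult_ac)
  have pos: "0 < card (dbl A)" "0 < card (dbl B)"
    using fin subgrpD(1)[OF sub(1)] subgrpD(1)[OF sub(2)] by (auto simp: dbl_def card_gt_0_iff)
  have LK: "L \<subseteq> K"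
  proof
    fix p assume p: "p \<in> L"
    have "dbl A \<subseteq> A" "dbl B \<subseteq> B" using subgrpD(2)[OF sub(1)] subgrpD(2)[OF sub(2)] by (auto simp: dbl_def)
    moreover have "s p \<in> dbl D"
      using p unfolding D_def dbl_plus unfolding subgrp_plus_def s_def L_def by blast
    ultimately show "p \<in> K" using p by (auto simp: K_def L_def)
  qed
  \<comment> \<open>The sum of the two components is the double of \<open>w\<close>, and
    \<open>w\<close> lies in \<open>D\<close>.\<close>
  have wK: "(w, w) \<in> K" using w sD(2) by (auto simp: K_def s_def dbl_def)
  let ?L' = "(\<lambda>p. p + (w, w)) ` L"
  have "?L' \<subseteq> K" using LK wK subgrpD(2)[OF sK] by blast
  have "L \<inter> ?L' = {}"
  proof -
    have "fst p + w \<notin> dbl A" if "p \<in> L" for p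
    proof
      assume "fst p + w \<in> dbl A"
      hence "(fst p + w) - fst p \<in> dbl A"
        using that by (intro subgrpD(4)[OF subgrp_dbl[OF sub(1)]]) (auto simp: L_def)
      with w(3) show False by simp
    qed
    thus ?thesis by (fastforce simp: L_def)
  qed
  have finL: "finite L" using LK finK by (rule finite_subset)
  have "card ?L' = card L" by (rule card_image) (simp add: inj_on_def)
  hence "2 * card L = card (L \<union> ?L')"
    using card_Un_disjoint[OF finL _ \<open>L \<inter> ?L' = {}\<close>] finL by simp
  also have "\<dots> \<le> card K" using LK \<open>?L' \<subseteq> K\<close> finK by (intro card_mono) auto
  finally have "card (tors D) * (2 * card L) \<le> card A * card B"
    using cP by (simp add: card_cartesian_product)
  also have "\<dots> = card L * (card (tors A) * card (tors B))"
    by (simp add: L_def card_cartesian_product card_dbl_tors[OF sub(1) fin(1)] card_dbl_tors[OF sub(2) fin(2)])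
  finally have "card L * (2 * card (tors D)) \<le> card L * (card (tors A) * card (tors B))"
    by (simp add: mult_ac)
  moreover have "0 < card L" using pos by (simp add: L_def card_cartesian_product)
  ultimately show ?thesis unfolding D_def by simp
qed

text \<open>Duality turns the sum of the two duals into the intersection of the double duals, which
  are \<open>A\<close> and \<open>B\<close>; dualizing once more gives the claim.\<close>

lemma perp_Int:
  assumes "subgrp A" "A \<subseteq> mixed \<alpha> \<beta>" "subgrp B" "B \<subseteq> mixed \<alpha> \<beta>"
  shows "perp \<alpha> \<beta> (A \<inter> B) = subgrp_plus (perp \<alpha> \<beta> A) (perp \<alpha> \<beta> B)"
proof -
  define S where "S = subgrp_plus (perp \<alpha> \<beta> A) (perp \<alpha> \<beta> B)"
  note S = subgrp_plus[of "perp \<alpha> \<beta> A" "perp \<alpha> \<beta> B", OF subgrp_perp subgrp_perp, folded S_def]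
  have "S \<subseteq> mixed \<alpha> \<beta>"
    using perp_subset subgrpD(2)[OF subgrp_mixed] unfolding S_def subgrp_plus_def by fastforce
  have "perp \<alpha> \<beta> S = perp \<alpha> \<beta> (perp \<alpha> \<beta> A) \<inter> perp \<alpha> \<beta> (perp \<alpha> \<beta> B)"
  proof
    show "perp \<alpha> \<beta> S \<subseteq> perp \<alpha> \<beta> (perp \<alpha> \<beta> A) \<inter> perp \<alpha> \<beta> (perp \<alpha> \<beta> B)"
      using S(2,3) unfolding perp_def[of _ _ S] perp_def[of _ _ "perp _ _ _"] by blast
    have "ip \<alpha> \<beta> u v = 0" if "u \<in> perp \<alpha> \<beta> (perp \<alpha> \<beta> A)" "u \<in> perp \<alpha> \<beta> (perp \<alpha> \<beta> B)" "v \<in> S" for u v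
    proof -
      from that(3) obtain a b where "a \<in> perp \<alpha> \<beta> A" "b \<in> perp \<alpha> \<beta> B" "v = a + b"
        unfolding S_def subgrp_plus_def by auto
      moreover from this that(1,2) have "ip \<alpha> \<beta> u a = 0" "ip \<alpha> \<beta> u b = 0"
        unfolding perp_def[of _ _ "perp _ _ _"] by blast+
      ultimately show ?thesis by (simp add: ip_add_right)
    qed
    thus "perp \<alpha> \<beta> (perp \<alpha> \<beta> A) \<inter> perp \<alpha> \<beta> (perp \<alpha> \<beta> B) \<subseteq> perp \<alpha> \<beta> S"
      unfolding perp_def[of _ _ S] using perp_subset[of \<alpha> \<beta> "perp \<alpha> \<beta> A"] by blast
  qed
  also have "\<dots> = A \<inter> B" using perp_perp assms by simp
  finally show ?thesis using perp_perp[OF S(1) \<open>S \<subseteq> mixed \<alpha> \<beta>\<close>] by (simp add: S_def)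
qed

lemma mixed_exponent_four: "x + x + (x + x) = 0" for x :: "(nat \<Rightarrow> bit) \<times> (nat \<Rightarrow> 4)"
proof -
  have "a + a + (a + a) = 0" for a :: 4 using cases_4[of a] by (auto simp: arith_4)
  moreover have "b + b + (b + b) = 0" for b :: bit using cases_bit[of b] by auto
  ultimately show ?thesis by (simp add: prod_eq_iff fun_eq_iff)
qed

lemma fst_double: "fst (x + x) = (0 :: nat \<Rightarrow> bit)"
  using cases_bit by (auto simp: fun_eq_iff)

lemma additive_fst: "additive_on H fst"
  by (simp add: additive_on_def)

text \<open>The types enter through additive bijections and \<kappa> through an order, so each
  conclusion is obtained by comparing the orders of \<open>dbl\<close>, of \<open>tors\<close> or of
  the binary projection of \<open>tors\<close>.\<close>

lemma intersection_type:
  assumes C1: "extended_perfect_code \<alpha> \<beta> C1" and C2: "extended_perfect_code \<alpha> \<beta> C2"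
    and f1: "additive_on (mixed \<gamma>' \<delta>') f1" "bij_betw f1 (mixed \<gamma>' \<delta>') (perp \<alpha> \<beta> C1)"
    and f2: "additive_on (mixed \<gamma>' \<delta>') f2" "bij_betw f2 (mixed \<gamma>' \<delta>') (perp \<alpha> \<beta> C2)"
    and f: "additive_on (mixed \<gamma> \<delta>) f" "bij_betw f (mixed \<gamma> \<delta>) (perp \<alpha> \<beta> (C1 \<inter> C2))"
    and \<kappa>: "card (fst ` tors (perp \<alpha> \<beta> (C1 \<inter> C2))) = 2 ^ \<kappa>"
    and "\<alpha> \<noteq> 0"
  shows "\<gamma> + \<delta> + 1 \<le> 2 * (\<gamma>' + \<delta>')" "\<delta>' \<le> \<delta>" "\<delta> \<le> 2 * \<delta>'" "\<gamma>' \<le> \<kappa>" "\<kappa> \<le> \<gamma>"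
    "\<delta>' = 0 \<Longrightarrow> \<kappa> = \<gamma>" "\<delta>' = 1 \<Longrightarrow> \<delta> = 1"
proof -
  interpret c1: extended_perfect_code \<alpha> \<beta> C1 by (rule C1)
  interpret c2: extended_perfect_code \<alpha> \<beta> C2 by (rule C2)
  define D1 where "D1 = perp \<alpha> \<beta> C1"
  define D2 where "D2 = perp \<alpha> \<beta> C2"
  define D where "D = perp \<alpha> \<beta> (C1 \<inter> C2)"
  have D: "D = subgrp_plus D1 D2"
    unfolding D_def D1_def D2_def by (rule perp_Int[OF c1.subgrp c1.C_mixed c2.subgrp c2.C_mixed])
  note n1 = card_iso_mixed[OF f1, folded D1_def]
  note n2 = card_iso_mixed[OF f2, folded D2_def]
  note n = card_iso_mixed[OF f, folded D_def]
  note s = subgrp_plus[OF n1(4) n2(4), folded D]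
  have dbl0: "fst x = 0" if "x \<in> dbl H" for x :: "(nat \<Rightarrow> bit) \<times> (nat \<Rightarrow> 4)" and H
    using that fst_double by (auto simp: dbl_def)
  have finD: "finite (dbl H)" if "finite H" for H :: "((nat \<Rightarrow> bit) \<times> (nat \<Rightarrow> 4)) set"
    using that by (simp add: dbl_def)
  have finT: "finite (tors H)" if "finite H" for H :: "((nat \<Rightarrow> bit) \<times> (nat \<Rightarrow> 4)) set"
    using that by (simp add: tors_def)

  \<comment> \<open>Doubles have zero binary part and \<open>ones\<close> has not, so
    \<open>ones\<close> can serve as the common element \<open>w\<close> of
    \<open>card_tors_plus\<close>.\<close>
  have "fst (ones \<alpha> \<beta>) 0 \<noteq> 0" using \<open>\<alpha> \<noteq> 0\<close> by (simp add: ones_def)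
  hence "ones \<alpha> \<beta> \<notin> dbl D1" using dbl0[of "ones \<alpha> \<beta>" D1] by auto
  hence "2 * card (tors D) \<le> card (tors D1) * card (tors D2)"
    unfolding D using c1.ones_in_perp c2.ones_in_perp
    by (intro card_tors_plus[OF n1(4) n2(4) n1(3) n2(3)]) (auto simp: D1_def D2_def)
  moreover have "(2::nat) ^ (2 * (\<gamma>' + \<delta>')) = 2 ^ (\<gamma>' + \<delta>') * 2 ^ (\<gamma>' + \<delta>')"
    by (simp only: mult_2 power_add)
  ultimately have "(2::nat) ^ (\<gamma> + \<delta> + 1) \<le> 2 ^ (2 * (\<gamma>' + \<delta>'))"
    by (simp add: n(1) n1(1) n2(1))
  thus "\<gamma> + \<delta> + 1 \<le> 2 * (\<gamma>' + \<delta>')" by (simp only: power_increasing_iff one_less_numeral_iff semiring_norm)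

  \<comment> \<open>The doubles of \<open>D\<close> contain those of \<open>D1\<close> and are sums
    of doubles of \<open>D1\<close> and \<open>D2\<close>; this bounds \<delta> on both
    sides.\<close>
  have dD1: "dbl D1 \<subseteq> dbl D" using s(2) by (auto simp: dbl_def)
  hence "card (dbl D1) \<le> card (dbl D)" using finD[OF n(3)] by (intro card_mono)
  thus "\<delta>' \<le> \<delta>" by (simp add: n(2) n1(2))
  have dD: "dbl D = (\<lambda>p. fst p + snd p) ` (dbl D1 \<times> dbl D2)"
    unfolding D dbl_plus unfolding subgrp_plus_def ..
  have "card (dbl D) \<le> card (dbl D1 \<times> dbl D2)"
    unfolding dD by (rule card_image_le) (use finD[OF n1(3)] finD[OF n2(3)] in simp)
  hence "(2::nat) ^ \<delta> \<le> 2 ^ (2 * \<delta>')" by (simp add: n(2) n1(2) n2(2) card_cartesian_product mult_2 flip: power_add)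
  thus "\<delta> \<le> 2 * \<delta>'" by (simp only: power_increasing_iff one_less_numeral_iff semiring_norm)

  have proj: "card (tors H) = card (fst ` tors H) * card {x \<in> tors H. fst x = 0}"
    if "subgrp H" "finite H" for H :: "((nat \<Rightarrow> bit) \<times> (nat \<Rightarrow> 4)) set"
    by (rule card_image_kernel[OF subgrp_tors[OF that(1)] additive_fst finT[OF that(2)]])
  \<comment> \<open>The kernel of the binary projection on \<open>tors D1\<close> has at most
    \<open>2 ^ \<delta>'\<close> elements, so its image has at least
    \<open>2 ^ \<gamma>'\<close>.\<close>
  have "{x \<in> tors D1. fst x = 0} \<subseteq> dbl D1"
    using c1.perp_binary_zero[OF \<open>\<alpha> \<noteq> 0\<close>] by (auto simp: D1_def tors_def)
  hence "card {x \<in> tors D1. fst x = 0} \<le> card (dbl D1)" using finD[OF n1(3)] by (intro card_mono)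
  moreover have "card (fst ` tors D1) \<le> card (fst ` tors D)"
    using s(2) finT[OF n(3)] by (intro card_mono) (auto simp: tors_def)
  ultimately have "card (tors D1) \<le> 2 ^ \<kappa> * 2 ^ \<delta>'"
    unfolding proj[OF n1(4,3)] using \<kappa> by (intro mult_le_mono) (simp_all add: D_def n1(2))
  hence "(2::nat) ^ (\<gamma>' + \<delta>') \<le> 2 ^ (\<kappa> + \<delta>')" by (simp add: n1(1) power_add)
  hence "\<gamma>' + \<delta>' \<le> \<kappa> + \<delta>'" by (simp only: power_increasing_iff one_less_numeral_iff semiring_norm)
  thus "\<gamma>' \<le> \<kappa>" by simp

  have cD: "2 ^ (\<gamma> + \<delta>) = 2 ^ \<kappa> * card {x \<in> tors D. fst x = 0}"
    using proj[OF n(4,3)] \<kappa>[folded D_def] n(1) by simp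
  have four: "v + v = 0" if "v \<in> dbl D" for v
  proof -
    have "v + v \<in> {x + x + (x + x) | x. True}" using that by (auto simp: dbl_def)
    thus ?thesis by (auto simp: mixed_exponent_four)
  qed
  \<comment> \<open>In the other direction, the kernel of the projection on \<open>tors D\<close>
    contains all doubles and so has at least \<open>2 ^ \<delta>\<close> elements.\<close>
  have "dbl D \<subseteq> D" using subgrpD(2)[OF n(4)] unfolding dbl_def by blast
  hence "dbl D \<subseteq> {x \<in> tors D. fst x = 0}" using four dbl0 by (auto simp: tors_def)
  hence "card (dbl D) \<le> card {x \<in> tors D. fst x = 0}" using finT[OF n(3)] by (intro card_mono) auto
  hence "2 ^ \<kappa> * 2 ^ \<delta> \<le> (2::nat) ^ (\<gamma> + \<delta>)" unfolding cD by (simp add: n(2))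
  hence "(2::nat) ^ (\<kappa> + \<delta>) \<le> 2 ^ (\<gamma> + \<delta>)" by (simp add: power_add)
  hence "\<kappa> + \<delta> \<le> \<gamma> + \<delta>" by (simp only: power_increasing_iff one_less_numeral_iff semiring_norm)
  thus "\<kappa> \<le> \<gamma>" by simp

  show "\<kappa> = \<gamma>" if "\<delta>' = 0"
  proof -
    have "\<delta> = 0" using \<open>\<delta> \<le> 2 * \<delta>'\<close> that by simp
    have "card (dbl D1) = 1" using n1(2) that by simp
    then obtain z where z: "dbl D1 = {z}" by (rule card_1_singletonE)
    have d0: "d + d = 0" if "d \<in> D1" for d
    proof -
      have "d + d \<in> dbl D1" using that unfolding dbl_def by blast
      moreover have "0 \<in> dbl D1" by (rule subgrpD(1)[OF subgrp_dbl[OF n1(4)]])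
      ultimately show ?thesis unfolding z by simp
    qed
    \<comment> \<open>\<open>D1\<close> is killed by doubling, yet a quaternary coordinate would be
      odd somewhere on it. Without such coordinates the binary projection is injective.\<close>
    have "\<beta> = 0"
    proof (rule ccontr)
      assume "\<beta> \<noteq> 0"
      then obtain d where "d \<in> D1" "snd d 0 + snd d 0 \<noteq> 0"
        using c1.perp_odd_coordinate[of 0] unfolding D1_def by blast
      moreover have "snd (d + d) 0 = snd d 0 + snd d 0" by simp
      ultimately show False using d0[of d] by simp
    qed
    hence "x = 0" if "x \<in> D" "fst x = 0" for x
      using that unfolding D_def perp_def mixed_def supported_def by (auto simp: prod_eq_iff fun_eq_iff)
    hence "{x \<in> tors D. fst x = 0} = {0}"
      using subgrpD(1)[OF subgrp_tors[OF n(4)]] by (auto simp: tors_def)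
    hence "(2::nat) ^ \<gamma> = 2 ^ \<kappa>" using cD \<open>\<delta> = 0\<close> by simp
    thus ?thesis by simp
  qed

  show "\<delta> = 1" if "\<delta>' = 1"
  proof -
    \<comment> \<open>The only candidate for a nonzero double: when there are just two doubles, the
      one that is 2 at a given quaternary position is the same for all positions. As
      \<open>w\<close> does not depend on the code, both duals have their doubles in the group of 0
      and \<open>w\<close>.\<close>
    define w :: "(nat \<Rightarrow> bit) \<times> (nat \<Rightarrow> 4)" where "w = (0, \<lambda>j. if j < \<beta> then 2 else 0)"
    have key: "dbl (perp \<alpha> \<beta> C') \<subseteq> {0, w}"
      if "extended_perfect_code \<alpha> \<beta> C'" "card (dbl (perp \<alpha> \<beta> C')) = 2" for C'
    proof
      interpret c: extended_perfect_code \<alpha> \<beta> C' by (rule that(1))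
      let ?E = "dbl (perp \<alpha> \<beta> C')"
      have zE: "0 \<in> ?E" by (rule subgrpD(1)[OF subgrp_dbl[OF subgrp_perp]])
      fix v assume v: "v \<in> ?E"
      have "v = w" if "v \<noteq> 0"
      proof -
        from \<open>card ?E = 2\<close> obtain p q where pq: "?E = {p, q}" by (auto simp: card_2_iff)
        have E: "u = v" if "u \<in> ?E" "u \<noteq> 0" for u
          using that zE v \<open>v \<noteq> 0\<close> unfolding pq by auto
        have "snd v j = 2" if j: "j < \<beta>" for j
        proof -
          obtain d where d: "d \<in> perp \<alpha> \<beta> C'" "snd d j + snd d j \<noteq> 0"
            using c.perp_odd_coordinate[OF j] by blast
          have dd: "snd (d + d) j = snd d j + snd d j" by simp
          have "snd (d + d) j \<noteq> 0" unfolding dd by (rule d(2))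
          moreover have "snd (0 :: (nat \<Rightarrow> bit) \<times> (nat \<Rightarrow> 4)) j = 0" by simp
          ultimately have "d + d \<noteq> 0" by metis
          hence "v = d + d" using E[of "d + d"] d(1) by (auto simp: dbl_def)
          moreover have "snd d j + snd d j = 2" using d(2) cases_4[of "snd d j"] by (auto simp: arith_4)
          ultimately show ?thesis using dd by simp
        qed
        moreover have "v \<in> mixed \<alpha> \<beta>"
          using v perp_subset[of \<alpha> \<beta> C'] subgrpD(2)[OF subgrp_mixed] unfolding dbl_def by blast
        ultimately have "snd v = snd w"
          by (auto simp: w_def fun_eq_iff mixed_def supported_def mem_Times_iff)
        moreover have "fst v = fst w" using dbl0[OF v] by (simp add: w_def)
        ultimately show ?thesis by (simp add: prod_eq_iff)
      qed
      thus "v \<in> {0, w}" by blast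
    qed
    have "dbl D1 \<subseteq> {0, w}" "dbl D2 \<subseteq> {0, w}"
      using key[OF C1] key[OF C2] n1(2) n2(2) that by (simp_all add: D1_def D2_def)
    moreover have "w + w = 0" by (simp add: w_def zero_prod_def fun_eq_iff)
    ultimately have "fst p + snd p \<in> {0, w}" if "p \<in> dbl D1 \<times> dbl D2" for p
    proof -
      have "fst p \<in> {0, w}" "snd p \<in> {0, w}"
        using that \<open>dbl D1 \<subseteq> {0, w}\<close> \<open>dbl D2 \<subseteq> {0, w}\<close> by (auto simp: mem_Times_iff)
      thus ?thesis using \<open>w + w = 0\<close> by auto
    qed
    hence "dbl D \<subseteq> {0, w}" unfolding dD by blast
    hence "card (dbl D) \<le> card {0, w}" by (intro card_mono) auto
    also have "\<dots> \<le> 2" by (simp add: card_insert_if)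
    finally have "(2::nat) ^ \<delta> \<le> 2 ^ 1" by (simp add: n(2))
    hence "\<delta> \<le> 1" by (simp only: power_increasing_iff one_less_numeral_iff semiring_norm)
    thus ?thesis using \<open>\<delta>' \<le> \<delta>\<close> that by simp
  qed
qed

section \<open>Coordinates\<close>

text \<open>Coordinates with respect to a finite basis, which exists as the finite space generates
  itself, identify the space with the functions from the basis to the field.\<close>

lemma (in vectorspace) card_eq_power_dim:
  assumes "finite (carrier V)" "finite (carrier K)"
  shows "card (carrier V) = card (carrier K) ^ dim"
proof -
  have "gen_set (carrier V)" using in_own_span[of "carrier V"] span_is_subset2[of "carrier V"] by auto
  hence "fin_dim" using assms(1) by (auto simp: fin_dim_def)
  then obtain B where B: "finite B" "basis B" using finite_basis_exists by blast
  have BV: "B \<subseteq> carrier V" using B(2) by (simp add: basis_def)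
  have dim: "dim = card B" by (rule dim_basis[OF B])
  have ex1: "\<exists>!a. a \<in> B \<rightarrow>\<^sub>E carrier K \<and> lincomb a B = v" if "v \<in> carrier V" for v
    using basis_criterion[OF B(1) BV] B(2) that by blast
  have closed: "lincomb a B \<in> carrier V" if "a \<in> B \<rightarrow>\<^sub>E carrier K" for a
    using that BV by (intro lincomb_closed) (auto simp: PiE_def)
  have "bij_betw (\<lambda>a. lincomb a B) (B \<rightarrow>\<^sub>E carrier K) (carrier V)"
    unfolding bij_betw_def
  proof
    show "inj_on (\<lambda>a. lincomb a B) (B \<rightarrow>\<^sub>E carrier K)"
    proof (rule inj_onI)
      fix a b assume "a \<in> B \<rightarrow>\<^sub>E carrier K" "b \<in> B \<rightarrow>\<^sub>E carrier K" "lincomb a B = lincomb b B"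
      thus "a = b" using ex1[OF closed] by blast
    qed
    show "(\<lambda>a. lincomb a B) ` (B \<rightarrow>\<^sub>E carrier K) = carrier V"
      using closed ex1 by blast
  qed
  hence "card (carrier V) = card (B \<rightarrow>\<^sub>E carrier K)" by (simp add: bij_betw_same_card)
  also have "\<dots> = card (carrier K) ^ dim" by (simp add: card_PiE B(1) dim)
  finally show ?thesis .
qed

text \<open>Entries beyond the dimension are unspecified; the default 0 makes the result supported
  below the dimension and the map additive.\<close>

definition coords :: "'a::zero vec \<Rightarrow> nat \<Rightarrow> 'a" where
  "coords v = (\<lambda>i. if i < dim_vec v then v $ i else 0)"

definition emb :: "bit vec \<times> 4 vec \<Rightarrow> (nat \<Rightarrow> bit) \<times> (nat \<Rightarrow> 4)" where
  "emb u = (coords (fst u), coords (snd u))"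

definition unemb :: "nat \<Rightarrow> nat \<Rightarrow> (nat \<Rightarrow> bit) \<times> (nat \<Rightarrow> 4) \<Rightarrow> bit vec \<times> 4 vec" where
  "unemb \<alpha> \<beta> f = (vec \<alpha> (fst f), vec \<beta> (snd f))"

lemma coords_add:
  "v \<in> carrier_vec n \<Longrightarrow> w \<in> carrier_vec n \<Longrightarrow> coords (v + w) = coords v + coords (w :: 'a::monoid_add vec)"
  by (auto simp: coords_def fun_eq_iff)

lemma coords_zero: "coords (0\<^sub>v n) = (0 :: nat \<Rightarrow> 'a::zero)"
  by (auto simp: coords_def fun_eq_iff)

lemma coords_supported: "v \<in> carrier_vec n \<Longrightarrow> coords v \<in> supported n"
  by (auto simp: coords_def supported_def)

lemma vec_coords: "v \<in> carrier_vec n \<Longrightarrow> vec n (coords v) = v"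
  by (auto simp: coords_def)

lemma coords_vec: "f \<in> supported n \<Longrightarrow> coords (vec n f) = f"
  by (auto simp: coords_def supported_def fun_eq_iff)

lemma Z2Z4_carrier: "carrier (Z2Z4 \<alpha> \<beta>) = carrier_vec \<alpha> \<times> carrier_vec \<beta>"
  by (simp add: Z2Z4_def DirProd_def monoid_vec_simps)

lemma Z2Z4_mult: "u \<otimes>\<^bsub>Z2Z4 \<alpha> \<beta>\<^esub> v = (fst u + fst v, snd u + snd v)"
  by (cases u; cases v) (simp add: Z2Z4_def DirProd_def monoid_vec_simps)

lemma Z2Z4_one: "\<one>\<^bsub>Z2Z4 \<alpha> \<beta>\<^esub> = (0\<^sub>v \<alpha>, 0\<^sub>v \<beta>)"
  by (simp add: Z2Z4_def DirProd_def monoid_vec_simps)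

lemma group_Z2Z4: "group (Z2Z4 \<alpha> \<beta>)"
  unfolding Z2Z4_def
  by (intro DirProd_group comm_group.axioms(2) comm_group_vec)

lemma emb_mixed: "u \<in> carrier (Z2Z4 \<alpha> \<beta>) \<Longrightarrow> emb u \<in> mixed \<alpha> \<beta>"
  by (auto simp: Z2Z4_carrier emb_def mixed_def coords_supported)

lemma unemb_carrier: "unemb \<alpha> \<beta> f \<in> carrier (Z2Z4 \<alpha> \<beta>)"
  by (simp add: Z2Z4_carrier unemb_def)

lemma unemb_emb: "u \<in> carrier (Z2Z4 \<alpha> \<beta>) \<Longrightarrow> unemb \<alpha> \<beta> (emb u) = u"
  by (auto simp: Z2Z4_carrier emb_def unemb_def vec_coords)

lemma emb_unemb: "f \<in> mixed \<alpha> \<beta> \<Longrightarrow> emb (unemb \<alpha> \<beta> f) = f"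
  by (cases f) (auto simp: emb_def unemb_def coords_vec mixed_def)

lemma emb_mult:
  "u \<in> carrier (Z2Z4 \<alpha> \<beta>) \<Longrightarrow> v \<in> carrier (Z2Z4 \<alpha> \<beta>) \<Longrightarrow> emb (u \<otimes>\<^bsub>Z2Z4 \<alpha> \<beta>\<^esub> v) = emb u + emb v"
  by (auto simp: Z2Z4_carrier Z2Z4_mult emb_def coords_add)

lemma unemb_add: "unemb \<alpha> \<beta> (f + g) = unemb \<alpha> \<beta> f \<otimes>\<^bsub>Z2Z4 \<alpha> \<beta>\<^esub> unemb \<alpha> \<beta> g"
  by (auto simp: Z2Z4_mult unemb_def)

lemma emb_one: "emb \<one>\<^bsub>Z2Z4 \<alpha> \<beta>\<^esub> = 0"
  by (simp add: Z2Z4_one emb_def coords_zero zero_prod_def)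

lemma inj_emb: "inj_on emb (carrier (Z2Z4 \<alpha> \<beta>))"
  by (rule inj_on_inverseI) (rule unemb_emb)

lemma emb_carrier: "emb ` carrier (Z2Z4 \<alpha> \<beta>) = mixed \<alpha> \<beta>"
proof
  show "mixed \<alpha> \<beta> \<subseteq> emb ` carrier (Z2Z4 \<alpha> \<beta>)"
    using emb_unemb unemb_carrier by (metis image_eqI subsetI)
qed (use emb_mixed in blast)

lemma additive_code_subset: "additive_code \<alpha> \<beta> H \<Longrightarrow> H \<subseteq> carrier (Z2Z4 \<alpha> \<beta>)"
  unfolding additive_code_def by (rule subgroup.subset)

lemma emb_code_mixed: "additive_code \<alpha> \<beta> H \<Longrightarrow> emb ` H \<subseteq> mixed \<alpha> \<beta>"
  using additive_code_subset emb_mixed by blast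

lemma subgrp_emb:
  assumes "additive_code \<alpha> \<beta> H"
  shows "subgrp (emb ` H)"
proof -
  have sg: "subgroup H (Z2Z4 \<alpha> \<beta>)" using assms by (simp add: additive_code_def)
  note sub = additive_code_subset[OF assms]
  show ?thesis unfolding subgrp_def
  proof (intro conjI ballI)
    show "0 \<in> emb ` H" using subgroup.one_closed[OF sg] emb_one by (metis imageI)
    fix x assume "x \<in> emb ` H"
    then obtain u where u: "u \<in> H" "x = emb u" by blast
    have "emb u + emb (inv\<^bsub>Z2Z4 \<alpha> \<beta>\<^esub> u) = 0"
      using emb_mult[of u \<alpha> \<beta> "inv\<^bsub>Z2Z4 \<alpha> \<beta>\<^esub> u"] u sub subgroup.m_inv_closed[OF sg u(1)]
        group.r_inv[OF group_Z2Z4, of u] emb_one by fastforce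
    hence "- x = emb (inv\<^bsub>Z2Z4 \<alpha> \<beta>\<^esub> u)" using u(2) by (simp add: neg_eq_iff_add_eq_0)
    thus "- x \<in> emb ` H" using subgroup.m_inv_closed[OF sg u(1)] by blast
    fix y assume "y \<in> emb ` H"
    then obtain v where v: "v \<in> H" "y = emb v" by blast
    have "emb (u \<otimes>\<^bsub>Z2Z4 \<alpha> \<beta>\<^esub> v) = x + y" using u v sub emb_mult by blast
    thus "x + y \<in> emb ` H" using subgroup.m_closed[OF sg u(1) v(1)] by (metis imageI)
  qed
qed

lemma inner_emb:
  assumes "u \<in> carrier (Z2Z4 \<alpha> \<beta>)" "v \<in> carrier (Z2Z4 \<alpha> \<beta>)"
  shows "inner_Z4 u v = ip \<alpha> \<beta> (emb u) (emb v)"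
proof -
  have d: "dim_vec (fst u) = \<alpha>" "dim_vec (fst v) = \<alpha>" "dim_vec (snd u) = \<beta>" "dim_vec (snd v) = \<beta>"
    using assms by (auto simp: Z2Z4_carrier)
  have "snd u \<bullet> snd v = (\<Sum>j<\<beta>. coords (snd u) j * coords (snd v) j)"
    unfolding scalar_prod_def d by (rule sum.cong) (auto simp: coords_def d)
  moreover have "(\<Sum>i<\<alpha>. of_bit (fst u $ i) * of_bit (fst v $ i) :: 4) =
    (\<Sum>i<\<alpha>. of_bit (coords (fst u) i) * of_bit (coords (fst v) i))"
    by (rule sum.cong) (auto simp: coords_def d)
  ultimately show ?thesis unfolding inner_Z4_def ip_def d emb_def by simp
qed

lemma emb_dual:
  assumes "H \<subseteq> carrier (Z2Z4 \<alpha> \<beta>)"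
  shows "emb ` additive_dual \<alpha> \<beta> H = perp \<alpha> \<beta> (emb ` H)"
proof
  show "emb ` additive_dual \<alpha> \<beta> H \<subseteq> perp \<alpha> \<beta> (emb ` H)"
  proof
    fix x assume "x \<in> emb ` additive_dual \<alpha> \<beta> H"
    then obtain u where u: "u \<in> carrier (Z2Z4 \<alpha> \<beta>)" "\<forall>v\<in>H. inner_Z4 u v = 0" "x = emb u"
      by (auto simp: additive_dual_def)
    have "ip \<alpha> \<beta> x (emb v) = 0" if "v \<in> H" for v
      using u inner_emb[OF u(1), of v] that assms by auto
    thus "x \<in> perp \<alpha> \<beta> (emb ` H)" using emb_mixed[OF u(1)] u(3) by (simp add: perp_def)
  qed
  show "perp \<alpha> \<beta> (emb ` H) \<subseteq> emb ` additive_dual \<alpha> \<beta> H"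
  proof
    fix x assume x: "x \<in> perp \<alpha> \<beta> (emb ` H)"
    define u where "u = unemb \<alpha> \<beta> x"
    have xm: "x \<in> mixed \<alpha> \<beta>" using x by (simp add: perp_def)
    have u: "u \<in> carrier (Z2Z4 \<alpha> \<beta>)" "emb u = x"
      unfolding u_def using xm by (simp_all add: emb_unemb unemb_carrier)
    have "inner_Z4 u v = 0" if "v \<in> H" for v
      using inner_emb[OF u(1), of v] u(2) x that assms by (auto simp: perp_def)
    hence "u \<in> additive_dual \<alpha> \<beta> H" using u(1) by (simp add: additive_dual_def)
    thus "x \<in> emb ` additive_dual \<alpha> \<beta> H" using u(2) by blast
  qed
qed

text \<open>Closure is checked after \<open>emb\<close> and pulled back by injectivity. In this way
  \<open>subgrp_perp\<close> shows that a dual is an additive code.\<close>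

lemma additive_code_of_emb:
  assumes "H \<subseteq> carrier (Z2Z4 \<alpha> \<beta>)" "subgrp (emb ` H)"
  shows "additive_code \<alpha> \<beta> H"
proof -
  interpret group "Z2Z4 \<alpha> \<beta>" by (rule group_Z2Z4)
  have pull: "u \<in> H" if "u \<in> carrier (Z2Z4 \<alpha> \<beta>)" "emb u \<in> emb ` H" for u
    using that assms(1) inj_emb[of \<alpha> \<beta>] by (meson inj_on_image_mem_iff)
  show ?thesis unfolding additive_code_def
  proof (rule subgroup.intro)
    show "H \<subseteq> carrier (Z2Z4 \<alpha> \<beta>)" by (rule assms(1))
    show "\<one>\<^bsub>Z2Z4 \<alpha> \<beta>\<^esub> \<in> H" using pull[of "\<one>\<^bsub>Z2Z4 \<alpha> \<beta>\<^esub>"] subgrpD(1)[OF assms(2)] by (simp add: emb_one)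
    fix u assume u: "u \<in> H"
    hence uc: "u \<in> carrier (Z2Z4 \<alpha> \<beta>)" using assms(1) by blast
    have "emb u + emb (inv\<^bsub>Z2Z4 \<alpha> \<beta>\<^esub> u) = 0"
      using emb_mult[OF uc inv_closed[OF uc]] r_inv[OF uc] by (simp add: emb_one)
    hence "emb (inv\<^bsub>Z2Z4 \<alpha> \<beta>\<^esub> u) = - emb u" by (metis neg_eq_iff_add_eq_0)
    moreover have "- emb u \<in> emb ` H" by (rule subgrpD(3)[OF assms(2)]) (use u in blast)
    ultimately show "inv\<^bsub>Z2Z4 \<alpha> \<beta>\<^esub> u \<in> H" using pull inv_closed[OF uc] by simp
    fix v assume v: "v \<in> H"
    hence vc: "v \<in> carrier (Z2Z4 \<alpha> \<beta>)" using assms(1) by blast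
    have "emb u + emb v \<in> emb ` H" by (rule subgrpD(2)[OF assms(2)]) (use u v in auto)
    thus "u \<otimes>\<^bsub>Z2Z4 \<alpha> \<beta>\<^esub> v \<in> H" using pull[OF m_closed[OF uc vc]] emb_mult[OF uc vc] by simp
  qed
qed

text \<open>The group isomorphism is inverted and conjugated by \<open>emb\<close> and
  \<open>unemb\<close>; \<open>bij_imp_of_type\<close> is the converse.\<close>

lemma of_type_imp_bij:
  assumes "of_type \<alpha> \<beta> \<gamma> \<delta> H"
  shows "\<exists>f. additive_on (mixed \<gamma> \<delta>) f \<and> bij_betw f (mixed \<gamma> \<delta>) (emb ` H)"
proof -
  let ?G = "(Z2Z4 \<alpha> \<beta>)\<lparr>carrier := H\<rparr>"
  have ac: "additive_code \<alpha> \<beta> H" and iso: "?G \<cong> Z2Z4 \<gamma> \<delta>" using assms by (auto simp: of_type_def)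
  have "group ?G"
    using ac group_Z2Z4 unfolding additive_code_def by (rule subgroup.subgroup_is_group)
  hence "Z2Z4 \<gamma> \<delta> \<cong> ?G" using iso by (rule group.iso_sym)
  then obtain \<phi> where "\<phi> \<in> iso (Z2Z4 \<gamma> \<delta>) ?G" by (auto simp: is_iso_def)
  hence \<phi>_iso: "\<phi> \<in> hom (Z2Z4 \<gamma> \<delta>) ?G" and bij: "bij_betw \<phi> (carrier (Z2Z4 \<gamma> \<delta>)) H"
    by (simp_all add: iso_def)
  have hom: "\<phi> (u \<otimes>\<^bsub>Z2Z4 \<gamma> \<delta>\<^esub> v) = \<phi> u \<otimes>\<^bsub>Z2Z4 \<alpha> \<beta>\<^esub> \<phi> v"
      if "u \<in> carrier (Z2Z4 \<gamma> \<delta>)" "v \<in> carrier (Z2Z4 \<gamma> \<delta>)" for u v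
    using \<phi>_iso that by (simp add: hom_def)
  note sub = additive_code_subset[OF ac]
  have \<phi>: "\<phi> u \<in> carrier (Z2Z4 \<alpha> \<beta>)" if "u \<in> carrier (Z2Z4 \<gamma> \<delta>)" for u
    using bij sub that by (auto simp: bij_betw_def)
  define f where "f = (\<lambda>x. emb (\<phi> (unemb \<gamma> \<delta> x)))"
  have "additive_on (mixed \<gamma> \<delta>) f"
    unfolding additive_on_def f_def unemb_add
    by (simp add: hom[OF unemb_carrier unemb_carrier] emb_mult[OF \<phi>[OF unemb_carrier] \<phi>[OF unemb_carrier]])
  moreover have "bij_betw f (mixed \<gamma> \<delta>) (emb ` H)"
  proof -
    have "bij_betw (unemb \<gamma> \<delta>) (mixed \<gamma> \<delta>) (carrier (Z2Z4 \<gamma> \<delta>))"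
      by (rule bij_betw_byWitness[where f' = emb])
         (use emb_unemb unemb_emb unemb_carrier emb_mixed in blast)+
    moreover have "bij_betw emb H (emb ` H)"
      using inj_on_subset[OF inj_emb sub] by (rule inj_on_imp_bij_betw)
    ultimately have "bij_betw (emb \<circ> (\<phi> \<circ> unemb \<gamma> \<delta>)) (mixed \<gamma> \<delta>) (emb ` H)"
      using bij by (intro bij_betw_trans)
    thus ?thesis by (simp add: f_def comp_def)
  qed
  ultimately show ?thesis by blast
qed

lemma bij_imp_of_type:
  assumes ac: "additive_code \<alpha> \<beta> H"
    and f: "additive_on (mixed \<gamma> \<delta>) f" "bij_betw f (mixed \<gamma> \<delta>) (emb ` H)"
  shows "of_type \<alpha> \<beta> \<gamma> \<delta> H"
proof -
  let ?G = "(Z2Z4 \<alpha> \<beta>)\<lparr>carrier := H\<rparr>"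
  note sub = additive_code_subset[OF ac]
  define \<phi> where "\<phi> = (\<lambda>u. unemb \<alpha> \<beta> (f (emb u)))"
  have "\<phi> (u \<otimes>\<^bsub>Z2Z4 \<gamma> \<delta>\<^esub> v) = \<phi> u \<otimes>\<^bsub>Z2Z4 \<alpha> \<beta>\<^esub> \<phi> v"
      if "u \<in> carrier (Z2Z4 \<gamma> \<delta>)" "v \<in> carrier (Z2Z4 \<gamma> \<delta>)" for u v
    using that additive_onD(1)[OF f(1) subgrp_mixed emb_mixed emb_mixed]
    by (simp add: \<phi>_def emb_mult unemb_add)
  moreover have bij: "bij_betw \<phi> (carrier (Z2Z4 \<gamma> \<delta>)) H"
  proof -
    have "bij_betw emb (carrier (Z2Z4 \<gamma> \<delta>)) (mixed \<gamma> \<delta>)"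
      using inj_emb emb_carrier by (auto simp: bij_betw_def)
    moreover have "bij_betw (unemb \<alpha> \<beta>) (emb ` H) H"
    proof (rule bij_betw_byWitness[where f' = emb])
      show "\<forall>a\<in>emb ` H. emb (unemb \<alpha> \<beta> a) = a" using emb_unemb emb_code_mixed[OF ac] by blast
      show "\<forall>a'\<in>H. unemb \<alpha> \<beta> (emb a') = a'" using unemb_emb sub by blast
      show "unemb \<alpha> \<beta> ` emb ` H \<subseteq> H"
      proof
        fix x assume "x \<in> unemb \<alpha> \<beta> ` emb ` H"
        then obtain u where "u \<in> H" "x = unemb \<alpha> \<beta> (emb u)" by blast
        moreover from this have "unemb \<alpha> \<beta> (emb u) = u" using unemb_emb sub by blast
        ultimately show "x \<in> H" by simp
      qed
    qed blast
    ultimately have "bij_betw (unemb \<alpha> \<beta> \<circ> (f \<circ> emb)) (carrier (Z2Z4 \<gamma> \<delta>)) H"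
      using f(2) by (intro bij_betw_trans)
    thus ?thesis by (simp add: \<phi>_def comp_def)
  qed
  ultimately have "\<phi> \<in> iso (Z2Z4 \<gamma> \<delta>) ?G"
    unfolding iso_def hom_def using bij_betwE[OF bij] by auto
  hence "Z2Z4 \<gamma> \<delta> \<cong> ?G" by (auto simp: is_iso_def)
  hence "?G \<cong> Z2Z4 \<gamma> \<delta>" by (rule group.iso_sym[OF group_Z2Z4])
  with ac show ?thesis by (simp add: of_type_def)
qed

text \<open>Replaces the dimension in \<open>kappa\<close> by an order, the only form in which
  \<kappa> is handled elsewhere.\<close>

lemma card_binary_torsion_projection:
  assumes ac: "additive_code \<alpha> \<beta> H"
  shows "card (fst ` tors (emb ` H)) = 2 ^ kappa \<alpha> \<beta> H"
proof -
  let ?W = "binary_torsion_projection \<alpha> \<beta> H"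
  let ?V = "module_vec TYPE(bit) \<alpha>"
  note sub = additive_code_subset[OF ac]
  have tors_iff: "emb u + emb u = 0 \<longleftrightarrow> u \<otimes>\<^bsub>Z2Z4 \<alpha> \<beta>\<^esub> u = \<one>\<^bsub>Z2Z4 \<alpha> \<beta>\<^esub>" if "u \<in> H" for u
  proof -
    have uc: "u \<in> carrier (Z2Z4 \<alpha> \<beta>)" using that sub by blast
    have "emb u + emb u = 0 \<longleftrightarrow> emb (u \<otimes>\<^bsub>Z2Z4 \<alpha> \<beta>\<^esub> u) = emb \<one>\<^bsub>Z2Z4 \<alpha> \<beta>\<^esub>"
      by (simp only: emb_mult[OF uc uc] emb_one)
    also have "\<dots> \<longleftrightarrow> u \<otimes>\<^bsub>Z2Z4 \<alpha> \<beta>\<^esub> u = \<one>\<^bsub>Z2Z4 \<alpha> \<beta>\<^esub>"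
      using group_Z2Z4[of \<alpha> \<beta>] uc
      by (intro inj_on_eq_iff[OF inj_emb]) (auto intro: monoid.m_closed monoid.one_closed group.is_monoid)
    finally show ?thesis .
  qed
  have img: "fst ` tors (emb ` H) = coords ` ?W"
  proof -
    have "tors (emb ` H) = emb ` {c \<in> H. c \<otimes>\<^bsub>Z2Z4 \<alpha> \<beta>\<^esub> c = \<one>\<^bsub>Z2Z4 \<alpha> \<beta>\<^esub>}"
      unfolding tors_def using tors_iff by blast
    thus ?thesis by (simp add: binary_torsion_projection_def image_image emb_def)
  qed
  have W_sub: "?W \<subseteq> carrier_vec \<alpha>"
    using sub by (auto simp: binary_torsion_projection_def Z2Z4_carrier)
  have inj: "inj_on coords ?W"
    by (rule inj_on_inverseI[where g = "vec \<alpha>"]) (use W_sub vec_coords in blast)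
  have sW: "subgrp (coords ` ?W)"
    unfolding img[symmetric] by (intro subgrp_image subgrp_tors subgrp_emb[OF ac] additive_fst)
  have pull: "v \<in> ?W" if "v \<in> carrier_vec \<alpha>" "coords v \<in> coords ` ?W" for v
  proof -
    from that(2) obtain w where w: "w \<in> ?W" "coords v = coords w" by blast
    hence "vec \<alpha> (coords v) = vec \<alpha> (coords w)" by simp
    thus ?thesis using w(1) W_sub that(1) vec_coords[of v \<alpha>] vec_coords[of w \<alpha>] by auto
  qed
  have zW: "0\<^sub>v \<alpha> \<in> ?W"
    using subgrpD(1)[OF sW] by (intro pull) (simp_all add: coords_zero)
  have "submodule (class_ring :: bit ring) ?W ?V"
  proof (rule submodule.intro)
    show "Module.module class_ring ?V" by (rule vec_module)
    show "?W \<subseteq> carrier ?V" using W_sub by (simp add: module_vec_simps)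
    show "\<zero>\<^bsub>?V\<^esub> \<in> ?W" using zW by (simp add: module_vec_simps)
    fix v assume v: "v \<in> ?W"
    show "v \<oplus>\<^bsub>?V\<^esub> w \<in> ?W" if w: "w \<in> ?W" for w
    proof -
      have vw: "v \<in> carrier_vec \<alpha>" "w \<in> carrier_vec \<alpha>" using v w W_sub by auto
      have "coords v + coords w \<in> coords ` ?W" using v w by (intro subgrpD(2)[OF sW]) auto
      hence "v + w \<in> ?W" using vw by (intro pull) (simp_all add: coords_add[OF vw])
      thus ?thesis by (simp add: module_vec_simps)
    qed
    show "c \<odot>\<^bsub>?V\<^esub> v \<in> ?W" for c
    proof -
      have vc: "v \<in> carrier_vec \<alpha>" using v W_sub by auto
      \<comment> \<open>The only scalars are 0 and 1, so a subgroup is already a subspace.\<close>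
      have "0 \<cdot>\<^sub>v v = 0\<^sub>v \<alpha>" "1 \<cdot>\<^sub>v v = v" using vc by auto
      thus ?thesis using v zW cases_bit[of c] by (auto simp: module_vec_simps)
    qed
  qed
  hence "vectorspace (class_ring :: bit ring) (?V\<lparr>carrier := ?W\<rparr>)"
    using vectorspace.subspace_is_vs[OF vec_vs] vec_vs by (auto simp: VectorSpace.subspace_def)
  moreover have "finite ?W"
  proof -
    have "coords ` ?W \<subseteq> supported \<alpha>" using W_sub coords_supported by blast
    hence "finite (coords ` ?W)" using card_supported_bit(1) by (rule finite_subset)
    thus ?thesis using inj by (rule finite_imageD)
  qed
  ultimately have "card ?W = 2 ^ kappa \<alpha> \<beta> H"
    using vectorspace.card_eq_power_dim[of class_ring "?V\<lparr>carrier := ?W\<rparr>"]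
    by (simp add: card_UNIV_bit kappa_def)
  thus ?thesis unfolding img using inj by (simp add: card_image)
qed

section \<open>The Gray map carries the Lee weight to the Hamming weight\<close>

lemma sum_lessThan_double: "(\<Sum>k<2 * n::nat. f k) = (\<Sum>j<n. f (2 * j) + f (2 * j + 1) :: nat)"
  by (induction n) simp_all

lemma gray4_inj: "gray4 x = gray4 y \<Longrightarrow> x = y"
  using cases_4[of x] cases_4[of y] by (elim disjE) (simp_all add: gray4_def)

lemma Gray_carrier:
  "u \<in> carrier (Z2Z4 \<alpha> \<beta>) \<Longrightarrow> Gray u \<in> carrier_vec (\<alpha> + 2 * \<beta>)"
  by (auto simp: Gray_def Z2Z4_carrier)

lemma Gray_nth:
  assumes "u \<in> carrier (Z2Z4 \<alpha> \<beta>)"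
  shows "i < \<alpha> \<Longrightarrow> Gray u $ i = fst u $ i"
    "j < \<beta> \<Longrightarrow> Gray u $ (\<alpha> + 2 * j) = fst (gray4 (snd u $ j))"
    "j < \<beta> \<Longrightarrow> Gray u $ (\<alpha> + (2 * j + 1)) = snd (gray4 (snd u $ j))"
proof -
  have d: "dim_vec (fst u) = \<alpha>" "dim_vec (snd u) = \<beta>" using assms by (auto simp: Z2Z4_carrier)
  show "i < \<alpha> \<Longrightarrow> Gray u $ i = fst u $ i" by (simp add: Gray_def d)
  show "j < \<beta> \<Longrightarrow> Gray u $ (\<alpha> + 2 * j) = fst (gray4 (snd u $ j))" by (simp add: Gray_def d Let_def)
  show "j < \<beta> \<Longrightarrow> Gray u $ (\<alpha> + (2 * j + 1)) = snd (gray4 (snd u $ j))" by (simp add: Gray_def d Let_def)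
qed

lemma inj_Gray: "inj_on Gray (carrier (Z2Z4 \<alpha> \<beta>))"
proof (rule inj_onI)
  fix u v assume uv: "u \<in> carrier (Z2Z4 \<alpha> \<beta>)" "v \<in> carrier (Z2Z4 \<alpha> \<beta>)" "Gray u = Gray v"
  have d: "dim_vec (fst u) = \<alpha>" "dim_vec (snd u) = \<beta>" "dim_vec (fst v) = \<alpha>" "dim_vec (snd v) = \<beta>"
    using uv by (auto simp: Z2Z4_carrier)
  have "fst u = fst v"
    by (rule eq_vecI) (use Gray_nth(1)[OF uv(1)] Gray_nth(1)[OF uv(2)] uv(3) d in auto)
  moreover have "snd u = snd v"
  proof (rule eq_vecI)
    fix j assume "j < dim_vec (snd v)"
    hence "gray4 (snd u $ j) = gray4 (snd v $ j)"
      using Gray_nth(2,3)[OF uv(1), of j] Gray_nth(2,3)[OF uv(2), of j] uv(3) d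
      by (simp add: prod_eq_iff)
    thus "snd u $ j = snd v $ j" by (rule gray4_inj)
  qed (simp add: d)
  ultimately show "u = v" by (simp add: prod_eq_iff)
qed

text \<open>The distance to the image of zero is enough: zero is a codeword, so the minimum distance
  bounds the weights of all other codewords.\<close>

lemma hamming_Gray_zero:
  assumes u: "u \<in> carrier (Z2Z4 \<alpha> \<beta>)"
  shows "hamming_dist (Gray u) (Gray \<one>\<^bsub>Z2Z4 \<alpha> \<beta>\<^esub>) = wt \<alpha> \<beta> (emb u)"
proof -
  let ?z = "\<one>\<^bsub>Z2Z4 \<alpha> \<beta>\<^esub>"
  let ?h = "\<lambda>k. if Gray u $ k \<noteq> Gray ?z $ k then 1 else 0 :: nat"
  have z: "?z \<in> carrier (Z2Z4 \<alpha> \<beta>)" by (simp add: Z2Z4_one Z2Z4_carrier)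
  have d: "dim_vec (fst u) = \<alpha>" "dim_vec (snd u) = \<beta>" using u by (auto simp: Z2Z4_carrier)
  have "{k. k < \<alpha> + 2 * \<beta> \<and> Gray u $ k \<noteq> Gray ?z $ k} = {k \<in> {..<\<alpha> + 2 * \<beta>}. Gray u $ k \<noteq> Gray ?z $ k}"
    by auto
  hence "hamming_dist (Gray u) (Gray ?z) = (\<Sum>k<\<alpha> + 2 * \<beta>. ?h k)"
    using Gray_carrier[OF u] by (simp add: hamming_dist_def sum.If_cases Collect_conj_eq lessThan_def)
  \<comment> \<open>The second block is summed in pairs, one for each quaternary coordinate.\<close>
  also have "\<dots> = (\<Sum>i<\<alpha>. ?h i) + (\<Sum>j<\<beta>. ?h (\<alpha> + 2 * j) + ?h (\<alpha> + (2 * j + 1)))"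
    by (simp only: sum_lessThan_add sum_lessThan_double)
  also have "(\<Sum>i<\<alpha>. ?h i) = (\<Sum>i<\<alpha>. if fst (emb u) i = 0 then 0 else 1)"
  proof (rule sum.cong)
    fix i assume "i \<in> {..<\<alpha>}"
    hence i: "i < \<alpha>" by simp
    show "?h i = (if fst (emb u) i = 0 then 0 else 1)"
      unfolding Gray_nth(1)[OF u i] Gray_nth(1)[OF z i]
      using i by (simp add: emb_def coords_def d Z2Z4_one)
  qed simp
  also have "(\<Sum>j<\<beta>. ?h (\<alpha> + 2 * j) + ?h (\<alpha> + (2 * j + 1))) = (\<Sum>j<\<beta>. lee (snd (emb u) j))"
  proof (rule sum.cong)
    fix j assume "j \<in> {..<\<beta>}"
    hence j: "j < \<beta>" by simp
    have "snd (emb u) j = snd u $ j" using j by (simp add: emb_def coords_def d)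
    thus "?h (\<alpha> + 2 * j) + ?h (\<alpha> + (2 * j + 1)) = lee (snd (emb u) j)"
      using cases_4[of "snd u $ j"]
      unfolding Gray_nth(2,3)[OF u j] Gray_nth(2,3)[OF z j]
      by (elim disjE) (simp_all add: Z2Z4_one j gray4_def lee_def)
  qed simp
  finally show ?thesis by (simp add: wt_def)
qed

lemma extended_perfect_emb:
  assumes "additive_extended_perfect \<alpha> \<beta> C"
  shows "extended_perfect_code \<alpha> \<beta> (emb ` C)"
proof
  have ac: "additive_code \<alpha> \<beta> C" using assms by (simp add: additive_extended_perfect_def)
  note sub = additive_code_subset[OF ac]
  show "subgrp (emb ` C)" by (rule subgrp_emb[OF ac])
  show em: "emb ` C \<subseteq> mixed \<alpha> \<beta>" by (rule emb_code_mixed[OF ac])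
  have iC: "inj_on emb C" "inj_on Gray C"
    using inj_on_subset[OF inj_emb sub] inj_on_subset[OF inj_Gray sub] by auto
  have finC: "finite C"
    using finite_subset[OF em card_mixed(1)] iC(1) by (rule finite_imageD)
  obtain t where t: "t \<ge> 2" "\<alpha> + 2 * \<beta> = 2 ^ t" "card (Gray ` C) = 2 ^ (2 ^ t - t - 1)"
    and md: "min_hamming_dist (Gray ` C) = 4"
    using assms by (auto simp: additive_extended_perfect_def extended_perfect_parameters_def)
  \<comment> \<open>Ensures that the subtraction of natural numbers in the exponent is
    exact.\<close>
  have "t < 2 ^ t" by (rule less_exp)
  hence "t + 1 \<le> 2 ^ t" by linarith
  hence "2 ^ t - t - 1 + (t + 1) = (2::nat) ^ t" by simp
  hence "(2::nat) ^ (2 ^ t) = 2 ^ (2 ^ t - t - 1) * 2 ^ (t + 1)" by (metis power_add)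
  thus "card (emb ` C) * (2 * (\<alpha> + 2 * \<beta>)) = 2 ^ (\<alpha> + 2 * \<beta>)"
    using t(3) iC by (simp add: t(2) card_image)
  fix x assume "x \<in> emb ` C" "x \<noteq> 0"
  then obtain c where c: "c \<in> C" "x = emb c" by blast
  let ?z = "\<one>\<^bsub>Z2Z4 \<alpha> \<beta>\<^esub>"
  have z: "?z \<in> C" using ac subgroup.one_closed by (auto simp: additive_code_def)
  have "c \<noteq> ?z" using \<open>x \<noteq> 0\<close> c(2) emb_one by auto
  hence ne: "Gray c \<noteq> Gray ?z" using iC(2) c(1) z by (auto dest: inj_onD)
  let ?S = "{hamming_dist x y |x y. x \<in> Gray ` C \<and> y \<in> Gray ` C \<and> x \<noteq> y}"
  have "?S \<subseteq> (\<lambda>p. hamming_dist (fst p) (snd p)) ` (Gray ` C \<times> Gray ` C)" by force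
  hence "finite ?S" by (rule finite_subset) (use finC in simp)
  moreover have "hamming_dist (Gray c) (Gray ?z) \<in> ?S" using c(1) z ne by blast
  ultimately have "Min ?S \<le> hamming_dist (Gray c) (Gray ?z)" by (rule Min_le)
  thus "4 \<le> wt \<alpha> \<beta> x"
    using md hamming_Gray_zero[of c \<alpha> \<beta>] c sub by (auto simp: min_hamming_dist_def)
qed

text \<open>The bounds with a subtraction are stated over \<open>int\<close>, where it is not
  truncated.\<close>

theorem theorem8:
  fixes C1 C2 :: "(bit vec \<times> 4 vec) set"
    and \<alpha> \<beta> \<gamma>' \<delta>' :: nat
  assumes "additive_extended_perfect \<alpha> \<beta> C1"
    and "additive_extended_perfect \<alpha> \<beta> C2"
    and "of_dual_type \<alpha> \<beta> \<gamma>' \<delta>' C1"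
    and "of_dual_type \<alpha> \<beta> \<gamma>' \<delta>' C2"
    and "\<alpha> \<noteq> 0"
  shows "\<exists>\<gamma> \<delta> \<kappa>.
    of_full_dual_type \<alpha> \<beta> \<gamma> \<delta> \<kappa> (C1 \<inter> C2) \<and>
    (\<delta>' = 0 \<longrightarrow> \<delta> = 0 \<and> \<gamma>' \<le> \<kappa> \<and> \<kappa> = \<gamma> \<and> int \<gamma> \<le> 2 * int \<gamma>' - 1) \<and>
    (\<delta>' = 1 \<longrightarrow> \<delta> = 1 \<and> \<gamma>' \<le> \<kappa> \<and> \<kappa> \<le> \<gamma> \<and> \<gamma> \<le> 2 * \<gamma>') \<and>
    (\<delta>' > 1 \<longrightarrow> \<delta> \<in> {\<delta>'..2 * \<delta>'} \<and> \<gamma>' \<le> \<kappa> \<and> \<kappa> \<le> \<gamma> \<and>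
       int \<gamma> \<le> 2 * int \<gamma>' + 2 * int \<delta>' - int \<delta> - 1)"
proof -
  let ?D = "additive_dual \<alpha> \<beta> (C1 \<inter> C2)"
  have sub: "C1 \<subseteq> carrier (Z2Z4 \<alpha> \<beta>)" "C2 \<subseteq> carrier (Z2Z4 \<alpha> \<beta>)"
    using assms(1,2) by (auto simp: additive_extended_perfect_def dest!: additive_code_subset)
  have int: "emb ` (C1 \<inter> C2) = emb ` C1 \<inter> emb ` C2"
    using inj_emb sub by (rule inj_on_image_Int)
  have D: "emb ` ?D = perp \<alpha> \<beta> (emb ` C1 \<inter> emb ` C2)"
    using emb_dual[of "C1 \<inter> C2" \<alpha> \<beta>] sub int by auto
  obtain f1 f2 where
    f1: "additive_on (mixed \<gamma>' \<delta>') f1" "bij_betw f1 (mixed \<gamma>' \<delta>') (perp \<alpha> \<beta> (emb ` C1))" and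
    f2: "additive_on (mixed \<gamma>' \<delta>') f2" "bij_betw f2 (mixed \<gamma>' \<delta>') (perp \<alpha> \<beta> (emb ` C2))"
    using assms(3,4) of_type_imp_bij emb_dual sub unfolding of_dual_type_def by metis
  have "subgrp (emb ` ?D)" unfolding D by (rule subgrp_perp)
  moreover have "?D \<subseteq> carrier (Z2Z4 \<alpha> \<beta>)" by (auto simp: additive_dual_def)
  ultimately have ac: "additive_code \<alpha> \<beta> ?D" by (intro additive_code_of_emb)
  have "finite (emb ` ?D)" unfolding D by (rule finite_subset[OF perp_subset card_mixed(1)])
  moreover have "x + x + (x + x) = 0" for x :: "(nat \<Rightarrow> bit) \<times> (nat \<Rightarrow> 4)" by (rule mixed_exponent_four)
  \<comment> \<open>The dual of the intersection has exponent four, so it has some type; its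
    parameters are the witnesses.\<close>
  ultimately obtain \<gamma> \<delta> f where f: "additive_on (mixed \<gamma> \<delta>) f" "bij_betw f (mixed \<gamma> \<delta>) (emb ` ?D)"
    using exponent_four_structure[OF \<open>subgrp (emb ` ?D)\<close>] by blast
  define \<kappa> where "\<kappa> = kappa \<alpha> \<beta> ?D"
  have "of_full_dual_type \<alpha> \<beta> \<gamma> \<delta> \<kappa> (C1 \<inter> C2)"
    using bij_imp_of_type[OF ac f] by (simp add: of_full_dual_type_def of_full_type_def \<kappa>_def)
  moreover note bounds = intersection_type[OF extended_perfect_emb[OF assms(1)] extended_perfect_emb[OF assms(2)]
    f1 f2 f[unfolded D] card_binary_torsion_projection[OF ac, unfolded D, folded \<kappa>_def] assms(5)]
  \<comment> \<open>All upper bounds for \<gamma> are instances of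
    \<open>\<gamma> + \<delta> + 1 \<le> 2 * (\<gamma>' + \<delta>')\<close>. For
    \<open>\<delta>' = \<delta> = 1\<close> the two units on the left cancel the 2 on the
    right.\<close>
  have "(\<delta>' = 0 \<longrightarrow> \<delta> = 0 \<and> \<gamma>' \<le> \<kappa> \<and> \<kappa> = \<gamma> \<and> int \<gamma> \<le> 2 * int \<gamma>' - 1) \<and>
    (\<delta>' = 1 \<longrightarrow> \<delta> = 1 \<and> \<gamma>' \<le> \<kappa> \<and> \<kappa> \<le> \<gamma> \<and> \<gamma> \<le> 2 * \<gamma>') \<and>
    (\<delta>' > 1 \<longrightarrow> \<delta> \<in> {\<delta>'..2 * \<delta>'} \<and> \<gamma>' \<le> \<kappa> \<and> \<kappa> \<le> \<gamma> \<and>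
       int \<gamma> \<le> 2 * int \<gamma>' + 2 * int \<delta>' - int \<delta> - 1)"
    using bounds by auto
  ultimately show ?thesis by blast
qed

end
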